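(* Let $n\geq 1$, let $T\subseteq\mathbb{R}^n$ and let $\beta$ be the corresponding betweenness relation on $T$. Assume that $T$ extends linearly in $2D$. Then the weak monadic $\Pi^1_1$-theory of $(T,\beta)$ is $\Pi^0_1$-hard.
   Context: Let $d$ be the Euclidean metric on $\mathbb{R}^n$. The betweenness relation $\beta$ on $\mathbb{R}^n$ is given by $\beta(s,t,u)$ iff $d(s,u)=d(s,t)+d(t,u)$; for $T\subseteq\mathbb{R}^n$, $(T,\beta)$ denotes the structure with domain $T$ and $\beta$ restricted to $T$. Points $s,t,u$ are collinear iff $\beta(s,t,u)\vee\beta(s,u,t)\vee\beta(t,s,u)$. For $U\subseteq\mathbb{R}^n$, a line in $U$ is a set $L\subseteq U$ such that: (i) $L$ contains two distinct points; (ii) any three points of $L$ are collinear; (iii) whenever $s,t\in L$, $s\neq t$, and $u\in U$ satisfies $\beta(s,u,t)$ or $\beta(s,t,u)$, then $u\in L$. An $m$-dimensional flat of $\mathbb{R}^n$ ($0\le m\le n$) is a set $\{h+r_1v_1+\dots+r_mv_m: r_i\in\mathbb{R}\}$ with $h\in\mathbb{R}^n$ and $v_1,\dots,v_m$ linearly independent nonzero vectors. A set $U\subseteq\mathbb{R}^n$ is a linearly regular $m$-dimensional flat if: (1) $U$ is contained in some $m$-dimensional flat; (2) $U$ is contained in no $(m-1)$-dimensional flat; (3) for every line $L$ in $U$, with $L'$ the Euclidean line of $\mathbb{R}^n$ containing $L$, for every $r\in L'$ and every $\epsilon>0$ there is $s\in L$ with $d(s,r)<\epsilon$; (4) if $L_1\neq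 L_2$ are lines in $U$ whose containing Euclidean lines meet, then $L_1\cap L_2\neq\emptyset$. A set $T\subseteq\mathbb{R}^n$ extends linearly in $mD$ if there exist a linearly regular $m$-dimensional flat $S$, $\epsilon>0$ and $x\in S\cap T$ with $\{u\in S: d(x,u)<\epsilon\}\subseteq T$. The weak monadic $\Pi^1_1$-theory of $(T,\beta)$ is the set of sentences $\forall X_1\cdots\forall X_k\,\varphi$ ($X_i$ unary relation variables, $\varphi$ first-order of vocabulary $\{\beta,X_1,\dots,X_k\}$) true in $(T,\beta)$ when the $X_i$ range over all finite subsets of $T$. Hardness is with respect to computable many-one reductions. *)

theory Defs
  imports "HOL-Analysis.Analysis" "HOL-Library.Nat_Bijection"
begin

section \<open>Betweenness and linearly regular flats\<close>

definition betw :: "real^'n \<Rightarrow> real^'n \<Rightarrow> real^'n \<Rightarrow> bool" where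
  "betw s t u \<longleftrightarrow> dist s u = dist s t + dist t u"

definition collin :: "real^'n \<Rightarrow> real^'n \<Rightarrow> real^'n \<Rightarrow> bool" where
  "collin s t u \<longleftrightarrow> betw s t u \<or> betw s u t \<or> betw t s u"

definition line_in :: "(real^'n) set \<Rightarrow> (real^'n) set \<Rightarrow> bool" where
  "line_in U L \<longleftrightarrow>
     L \<subseteq> U \<and>
     (\<exists>s\<in>L. \<exists>t\<in>L. s \<noteq> t) \<and>
     (\<forall>s\<in>L. \<forall>t\<in>L. \<forall>u\<in>L. collin s t u) \<and>
     (\<forall>s\<in>L. \<forall>t\<in>L. \<forall>u\<in>U. s \<noteq> t \<and> (betw s u t \<or> betw s t u) \<longrightarrow> u \<in> L)"

text \<open>The vectors are an indexed family, so its independence includes injectivity of the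
  indexing. Euclidean lines are the flats of dimension 1.\<close>

definition flat :: "nat \<Rightarrow> (real^'n) set \<Rightarrow> bool" where
  "flat m F \<longleftrightarrow>
     (\<exists>h v. inj_on v {..<m} \<and> independent (v ` {..<m}) \<and>
            F = {h + (\<Sum>i<m. r i *\<^sub>R v i) | r :: nat \<Rightarrow> real. True})"

text \<open>In the third and fourth clause the Euclidean line containing a given line of \<open>U\<close> is
  unique, since the latter has two distinct points. For \<open>m = 0\<close> the second clause is void: there
  are no flats of dimension \<open>-1\<close>.\<close>

definition linearly_regular_flat :: "nat \<Rightarrow> (real^'n) set \<Rightarrow> bool" where
  "linearly_regular_flat m U \<longleftrightarrow>
     (\<exists>F. flat m F \<and> U \<subseteq> F) \<and>
     (\<forall>k. m = Suc k \<longrightarrow> \<not> (\<exists>F. flat k F \<and> U \<subseteq> F)) \<and>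
     (\<forall>L L'. line_in U L \<and> flat 1 L' \<and> L \<subseteq> L' \<longrightarrow>
        (\<forall>r\<in>L'. \<forall>\<epsilon>>0. \<exists>s\<in>L. dist s r < \<epsilon>)) \<and>
     (\<forall>L1 L2 L1' L2'. line_in U L1 \<and> line_in U L2 \<and> L1 \<noteq> L2 \<and>
        flat 1 L1' \<and> L1 \<subseteq> L1' \<and> flat 1 L2' \<and> L2 \<subseteq> L2' \<and> L1' \<inter> L2' \<noteq> {} \<longrightarrow>
        L1 \<inter> L2 \<noteq> {})"

definition extends_linearly :: "nat \<Rightarrow> (real^'n) set \<Rightarrow> bool" where
  "extends_linearly m T \<longleftrightarrow>
     (\<exists>S \<epsilon> x. linearly_regular_flat m S \<and> \<epsilon> > 0 \<and> x \<in> S \<inter> T \<and> {u \<in> S. dist x u < \<epsilon>} \<subseteq> T)"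

section \<open>Weak monadic universal second-order sentences\<close>

text \<open>First-order formulas over one ternary relation symbol and the unary relation variables
  \<open>X\<^sub>0, X\<^sub>1, \<dots>\<close>; \<open>Mem i x\<close> is the atom \<open>X\<^sub>i(x)\<close>.\<close>

datatype fm =
    Eq nat nat
  | Bet nat nat nat
  | Mem nat nat
  | Neg fm
  | Conj fm fm
  | Ex nat fm

primrec fo_vars :: "fm \<Rightarrow> nat set" where
  "fo_vars (Eq x y) = {x, y}"
| "fo_vars (Bet x y z) = {x, y, z}"
| "fo_vars (Mem i x) = {x}"
| "fo_vars (Neg \<phi>) = fo_vars \<phi>"
| "fo_vars (Conj \<phi> \<psi>) = fo_vars \<phi> \<union> fo_vars \<psi>"
| "fo_vars (Ex x \<phi>) = fo_vars \<phi> - {x}"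

primrec so_vars :: "fm \<Rightarrow> nat set" where
  "so_vars (Eq x y) = {}"
| "so_vars (Bet x y z) = {}"
| "so_vars (Mem i x) = {i}"
| "so_vars (Neg \<phi>) = so_vars \<phi>"
| "so_vars (Conj \<phi> \<psi>) = so_vars \<phi> \<union> so_vars \<psi>"
| "so_vars (Ex x \<phi>) = so_vars \<phi>"

primrec sat :: "'a set \<Rightarrow> ('a \<Rightarrow> 'a \<Rightarrow> 'a \<Rightarrow> bool) \<Rightarrow> (nat \<Rightarrow> 'a set) \<Rightarrow> (nat \<Rightarrow> 'a) \<Rightarrow> fm \<Rightarrow> bool" where
  "sat D B X v (Eq x y) \<longleftrightarrow> v x = v y"
| "sat D B X v (Bet x y z) \<longleftrightarrow> B (v x) (v y) (v z)"
| "sat D B X v (Mem i x) \<longleftrightarrow> v x \<in> X i"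
| "sat D B X v (Neg \<phi>) \<longleftrightarrow> \<not> sat D B X v \<phi>"
| "sat D B X v (Conj \<phi> \<psi>) \<longleftrightarrow> sat D B X v \<phi> \<and> sat D B X v \<psi>"
| "sat D B X v (Ex x \<phi>) \<longleftrightarrow> (\<exists>a\<in>D. sat D B X (v(x := a)) \<phi>)"

lemma sat_cong:
  assumes "\<And>x. x \<in> fo_vars \<phi> \<Longrightarrow> v x = w x" and "\<And>i. i \<in> so_vars \<phi> \<Longrightarrow> X i = Y i"
  shows "sat D B X v \<phi> \<longleftrightarrow> sat D B Y w \<phi>"
  using assms
proof (induction \<phi> arbitrary: v w)
  case (Ex x \<phi>)
  have "sat D B X (v(x := a)) \<phi> \<longleftrightarrow> sat D B Y (w(x := a)) \<phi>" for a
    using Ex.prems by (intro Ex.IH) auto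
  then show ?case by simp
next
  case (Conj \<phi> \<psi>)
  have "sat D B X v \<phi> \<longleftrightarrow> sat D B Y w \<phi>" "sat D B X v \<psi> \<longleftrightarrow> sat D B Y w \<psi>"
    using Conj.prems by (auto intro!: Conj.IH)
  then show ?case by simp
qed auto

text \<open>The pair \<open>(k, \<phi>)\<close> stands for the sentence \<open>\<forall>X\<^sub>0 \<dots> \<forall>X\<^sub>k\<^sub>-\<^sub>1. \<phi>\<close>. As \<open>\<phi>\<close> has no free
  first-order variables, the choice of the first-order assignment \<open>v\<close> is immaterial
  (lemma \<open>sat_cong\<close>).\<close>

definition weak_univ_theory :: "'a set \<Rightarrow> ('a \<Rightarrow> 'a \<Rightarrow> 'a \<Rightarrow> bool) \<Rightarrow> (nat \<times> fm) set" where
  "weak_univ_theory D B =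
     {(k, \<phi>). fo_vars \<phi> = {} \<and> so_vars \<phi> \<subseteq> {..<k} \<and>
        (\<forall>X v. (\<forall>i<k. finite (X i) \<and> X i \<subseteq> D) \<longrightarrow> sat D B X v \<phi>)}"

text \<open>A Goedel numbering by the Cantor pairing function.\<close>

primrec fm_code :: "fm \<Rightarrow> nat" where
  "fm_code (Eq x y) = prod_encode (0, prod_encode (x, y))"
| "fm_code (Bet x y z) = prod_encode (1, prod_encode (x, prod_encode (y, z)))"
| "fm_code (Mem i x) = prod_encode (2, prod_encode (i, x))"
| "fm_code (Neg \<phi>) = prod_encode (3, fm_code \<phi>)"
| "fm_code (Conj \<phi> \<psi>) = prod_encode (4, prod_encode (fm_code \<phi>, fm_code \<psi>))"
| "fm_code (Ex x \<phi>) = prod_encode (5, prod_encode (x, fm_code \<phi>))"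

definition sentence_code :: "nat \<times> fm \<Rightarrow> nat" where
  "sentence_code s = prod_encode (fst s, fm_code (snd s))"

lemma fm_code_inject: "fm_code \<phi> = fm_code \<psi> \<longleftrightarrow> \<phi> = \<psi>"
proof (induction \<phi> arbitrary: \<psi>)
  case (Eq x y) then show ?case by (cases \<psi>) auto
next
  case (Bet x y z) then show ?case by (cases \<psi>) auto
next
  case (Mem i x) then show ?case by (cases \<psi>) auto
next
  case (Neg \<phi>) then show ?case by (cases \<psi>) auto
next
  case (Conj \<phi>1 \<phi>2) then show ?case by (cases \<psi>) auto
next
  case (Ex x \<phi>) then show ?case by (cases \<psi>) auto
qed

lemma inj_sentence_code: "inj sentence_code"
  by (auto simp: inj_def sentence_code_def fm_code_inject)

section \<open>Partial recursive functions and many-one hardness\<close>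

datatype recf =
    Zero
  | Succ
  | Proj nat
  | Comp recf "recf list"
  | Prec recf recf
  | Mu recf

text \<open>\<open>computes f xs y\<close>: the program \<open>f\<close> halts on the arguments \<open>xs\<close> with output \<open>y\<close>. In
  \<open>Prec f g\<close> the recursion runs over the first argument; in \<open>Mu f\<close> the minimised argument is the
  first one, and all smaller values have to be defined and nonzero.\<close>

inductive computes :: "recf \<Rightarrow> nat list \<Rightarrow> nat \<Rightarrow> bool" where
  Zero: "computes Zero xs 0"
| Succ: "computes Succ [x] (Suc x)"
| Proj: "i < length xs \<Longrightarrow> computes (Proj i) xs (xs ! i)"
| Comp: "list_all2 (\<lambda>g y. computes g xs y) gs ys \<Longrightarrow> computes f ys z \<Longrightarrow>
         computes (Comp f gs) xs z"
| Prec_0: "computes f xs y \<Longrightarrow> computes (Prec f g) (0 # xs) y"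
| Prec_Suc: "computes (Prec f g) (n # xs) r \<Longrightarrow> computes g (n # r # xs) y \<Longrightarrow>
         computes (Prec f g) (Suc n # xs) y"
| Mu: "computes f (n # xs) 0 \<Longrightarrow> (\<forall>i<n. \<exists>y>0. computes f (i # xs) y) \<Longrightarrow>
         computes (Mu f) xs n"

inductive_cases computes_ZeroE: "computes Zero xs y"
inductive_cases computes_SuccE: "computes Succ xs y"
inductive_cases computes_ProjE: "computes (Proj i) xs y"
inductive_cases computes_CompE: "computes (Comp f gs) xs y"
inductive_cases computes_Prec_0E: "computes (Prec f g) (0 # xs) y"
inductive_cases computes_Prec_SucE: "computes (Prec f g) (Suc n # xs) y"
inductive_cases computes_MuE: "computes (Mu f) xs y"

lemma computes_deterministic:
  "computes f xs y \<Longrightarrow> computes f xs z \<Longrightarrow> y = z"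
proof (induction arbitrary: z rule: computes.induct)
  case (Zero xs)
  then show ?case by (rule computes_ZeroE) simp
next
  case (Succ x)
  then show ?case by (rule computes_SuccE) simp
next
  case (Proj i xs)
  from Proj.prems show ?case by (rule computes_ProjE) simp
next
  case (Comp xs gs ys f w)
  from Comp.prems obtain ys' where
    1: "list_all2 (\<lambda>g y. computes g xs y) gs ys'" and 2: "computes f ys' z"
    by (rule computes_CompE)
  have "ys = ys'"
    using Comp.IH(1) 1 by (simp add: list_all2_conv_all_nth list_eq_iff_nth_eq)
  with 2 Comp.IH show ?case by blast
next
  case (Prec_0 f xs y g)
  from Prec_0.prems have "computes f xs z" by (rule computes_Prec_0E)
  then show ?case by (rule Prec_0.IH)
next
  case (Prec_Suc f g n xs r y)
  from Prec_Suc.prems obtain r' where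
    1: "computes (Prec f g) (n # xs) r'" and 2: "computes g (n # r' # xs) z"
    by (rule computes_Prec_SucE)
  have "r = r'" using 1 by (rule Prec_Suc.IH(1))
  with 2 show ?case using Prec_Suc.IH(2) by simp
next
  case (Mu f n xs)
  from Mu.prems have 1: "computes f (z # xs) 0" and 2: "\<forall>i<z. \<exists>y>0. computes f (i # xs) y"
    by (auto elim: computes_MuE)
  have "\<not> n < z"
  proof
    assume "n < z"
    with 2 obtain y where "y > 0" "computes f (n # xs) y" by blast
    with Mu.IH(1) show False by blast
  qed
  moreover have "\<not> z < n"
  proof
    assume "z < n"
    with Mu.IH(2) obtain y where "y > 0" "\<And>w. computes f (z # xs) w \<Longrightarrow> y = w" by blast
    with 1 show False by blast
  qed
  ultimately show ?case by simp
qed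

definition computable :: "(nat \<Rightarrow> nat) \<Rightarrow> bool" where
  "computable f \<longleftrightarrow> (\<exists>p. \<forall>x. computes p [x] (f x))"

definition rec_enum :: "nat set \<Rightarrow> bool" where
  "rec_enum A \<longleftrightarrow> (\<exists>p. \<forall>x. x \<in> A \<longleftrightarrow> (\<exists>y. computes p [x] y))"

definition Pi01 :: "nat set \<Rightarrow> bool" where
  "Pi01 A \<longleftrightarrow> rec_enum (- A)"

definition many_one_reducible :: "nat set \<Rightarrow> nat set \<Rightarrow> bool" where
  "many_one_reducible A B \<longleftrightarrow> (\<exists>f. computable f \<and> (\<forall>x. x \<in> A \<longleftrightarrow> f x \<in> B))"

definition Pi01_hard :: "nat set \<Rightarrow> bool" where
  "Pi01_hard B \<longleftrightarrow> (\<forall>A. Pi01 A \<longrightarrow> many_one_reducible A B)"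

end

theory Submission
  imports Defs
begin

text \<open>
  A halting computation of a fixed program on input \<open>e\<close> is witnessed by a finite set of facts
  ``\<open>f\<close> maps \<open>xs\<close> to \<open>y\<close>'', each of which follows from others by one rule. Such a set is coded by
  finitely many points: numbers are points on a ray, ordered by their distance from its first point,
  and a fact \<open>t\<close> has the number \<open>n\<close> as its \<open>i\<close>-th entry iff some point of the \<open>i\<close>-th set of links
  lies between \<open>t\<close> and \<open>n\<close>. Whether all facts follow from others is a first-order property
  in which all quantifiers range over the coding sets, so the remaining points of the structure do
  not matter: any finite sets with this property witness that the program halts, no matter
  how they lie in space.

  Conversely, the code of a given computation exists in every piece of a linearly regular plane. Take
  the numbers on one line and the facts on another one that intersects it. The segments that
  join facts and numbers then lie on distinct lines, and each contains infinitely many points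
  of the plane by density, hence one that lies on none of the other finitely many segments.

  Thus the program diverges on \<open>e\<close> iff the negated property holds for all finite sets.
\<close>

section \<open>Computable functions\<close>

lemma computes_Comp1: "computes g xs y \<Longrightarrow> computes f [y] z \<Longrightarrow> computes (Comp f [g]) xs z"
  by (rule computes.Comp[of _ _ "[y]"]) auto

lemma computes_Comp2:
  "computes g xs y \<Longrightarrow> computes h xs y' \<Longrightarrow> computes f [y, y'] z \<Longrightarrow> computes (Comp f [g, h]) xs z"
  by (rule computes.Comp[of _ _ "[y, y']"]) auto

lemma computes_Proj0: "computes (Proj 0) (x # xs) x"
  using computes.Proj[of 0 "x # xs"] by simp

lemma computes_Proj1: "computes (Proj 1) (x # y # xs) y"
  using computes.Proj[of 1 "x # y # xs"] by simp

primrec const_prog :: "nat \<Rightarrow> recf" where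
  "const_prog 0 = Zero"
| "const_prog (Suc c) = Comp Succ [const_prog c]"

lemma computes_const: "computes (const_prog c) xs c"
  by (induction c) (auto intro: computes.Zero computes.Succ computes_Comp1)

definition add_prog :: recf where
  "add_prog = Prec (Proj 0) (Comp Succ [Proj 1])"

lemma computes_add: "computes add_prog [m, n] (m + n)"
  unfolding add_prog_def
proof (induction m)
  case 0
  show ?case using computes.Prec_0[OF computes_Proj0] by simp
next
  case (Suc m)
  show ?case
    using computes.Prec_Suc[OF Suc computes_Comp1[OF computes_Proj1 computes.Succ]] by simp
qed

definition triangle_prog :: recf where
  "triangle_prog = Prec Zero (Comp add_prog [Proj 1, Comp Succ [Proj 0]])"

lemma computes_triangle: "computes triangle_prog [n] (triangle n)"
  unfolding triangle_prog_def
proof (induction n)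
  case 0
  show ?case using computes.Prec_0[OF computes.Zero] by simp
next
  case (Suc n)
  show ?case
    using computes.Prec_Suc[OF Suc computes_Comp2[OF computes_Proj1
        computes_Comp1[OF computes_Proj0 computes.Succ] computes_add]] by simp
qed

text \<open>\<open>prod_encode\<close> sends the pair of \<open>m\<close> and \<open>n\<close> to
  \<open>triangle (m + n) + m\<close>.\<close>

definition pair_prog :: recf where
  "pair_prog = Comp add_prog [Comp triangle_prog [add_prog], Proj 0]"

lemma computes_pair: "computes pair_prog [m, n] (prod_encode (m, n))"
  using computes_Comp2[OF computes_Comp1[OF computes_add computes_triangle] computes_Proj0
      computes_add, of m n]
  by (simp add: pair_prog_def prod_encode_def)

lemma computable_const: "computable (\<lambda>_. c)"
  unfolding computable_def using computes_const by blast

lemma computable_id: "computable (\<lambda>x. x)"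
  unfolding computable_def using computes_Proj0 by blast

lemma computable_pair:
  assumes "computable f" "computable g"
  shows "computable (\<lambda>x. prod_encode (f x, g x))"
proof -
  obtain p q where "\<forall>x. computes p [x] (f x)" "\<forall>x. computes q [x] (g x)"
    using assms by (auto simp: computable_def)
  then have "\<forall>x. computes (Comp pair_prog [p, q]) [x] (prod_encode (f x, g x))"
    using computes_Comp2 computes_pair by blast
  then show ?thesis unfolding computable_def by blast
qed

lemma computable_iterate:
  assumes "computable w"
  shows "computable (\<lambda>n. (w ^^ n) c)"
proof -
  obtain p where p: "\<forall>x. computes p [x] (w x)"
    using assms by (auto simp: computable_def)
  have "computes (Prec (const_prog c) (Comp p [Proj 1])) [n] ((w ^^ n) c)" for n
  proof (induction n)
    case 0
    show ?case using computes.Prec_0[OF computes_const] by simp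
  next
    case (Suc n)
    show ?case
      using computes.Prec_Suc[OF Suc computes_Comp1[OF computes_Proj1 p[rule_format]]] by simp
  qed
  then show ?thesis unfolding computable_def by blast
qed

section \<open>Derivations of computations\<close>

text \<open>One step of a derivation of \<open>computes\<close>, whose premises are facts of \<open>R\<close>. Every premise concerns
  a proper subprogram or, for \<open>Prec\<close>, a smaller recursion argument, so a relation \<open>R\<close> whose facts
  are all justified is sound: no separate condition of well-foundedness is needed.\<close>

fun justified :: "(recf \<Rightarrow> nat list \<Rightarrow> nat \<Rightarrow> bool) \<Rightarrow> recf \<Rightarrow> nat list \<Rightarrow> nat \<Rightarrow> bool" where
  "justified R Zero xs y \<longleftrightarrow> y = 0"
| "justified R Succ xs y \<longleftrightarrow> (\<exists>x. xs = [x] \<and> y = Suc x)"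
| "justified R (Proj i) xs y \<longleftrightarrow> i < length xs \<and> y = xs ! i"
| "justified R (Comp f gs) xs y \<longleftrightarrow> (\<exists>ys. list_all2 (\<lambda>g. R g xs) gs ys \<and> R f ys y)"
| "justified R (Prec f g) xs y \<longleftrightarrow> (\<exists>n ns. xs = n # ns \<and>
     (n = 0 \<and> R f ns y \<or> (\<exists>m r. n = Suc m \<and> R (Prec f g) (m # ns) r \<and> R g (m # r # ns) y)))"
| "justified R (Mu f) xs y \<longleftrightarrow> R f (y # xs) 0 \<and> (\<forall>i<y. \<exists>w>0. R f (i # xs) w)"

text \<open>\<open>R\<close> occurs only positively in the clauses of \<open>justified\<close>, so a
  fact stays justified when more facts are added.\<close>

lemma justified_mono:
  assumes "justified R f xs y" "\<And>f xs y. R f xs y \<Longrightarrow> R' f xs y"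
  shows "justified R' f xs y"
proof (cases f)
  case (Comp h gs)
  then show ?thesis using assms by simp (metis (mono_tags, lifting) list_all2_mono)
next
  case (Prec g h)
  then show ?thesis using assms by simp blast
next
  case (Mu g)
  then show ?thesis using assms by simp blast
qed (use assms in auto)

text \<open>The second component is the number of arguments with which a subprogram gets called.\<close>

fun subprograms :: "recf \<Rightarrow> nat \<Rightarrow> (recf \<times> nat) list" where
  "subprograms (Comp f gs) a =
     (Comp f gs, a) # subprograms f (length gs) @ concat (map (\<lambda>g. subprograms g a) gs)"
| "subprograms (Prec f g) a = (Prec f g, a) # subprograms f (a - 1) @ subprograms g (Suc a)"
| "subprograms (Mu f) a = (Mu f, a) # subprograms f (Suc a)"
| "subprograms f a = [(f, a)]"

lemma subprograms_self: "(f, a) \<in> set (subprograms f a)"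
  by (cases f) auto

text \<open>The hypothesis is restricted to the finite list of subprograms and arities, so that
  finitely many formulas can express it.\<close>

lemma computes_if_justified:
  assumes "\<And>g zs y. (g, length zs) \<in> set (subprograms f (length xs)) \<Longrightarrow> R g zs y \<Longrightarrow> justified R g zs y"
    and "R f xs y"
  shows "computes f xs y"
  using assms
proof (induction f arbitrary: xs y)
  case Zero
  from Zero.prems(1)[OF subprograms_self Zero.prems(2)] show ?case by (auto intro: computes.Zero)
next
  case Succ
  from Succ.prems(1)[OF subprograms_self Succ.prems(2)] show ?case by (auto intro: computes.Succ)
next
  case (Proj i)
  from Proj.prems(1)[OF subprograms_self Proj.prems(2)] show ?case by (auto intro: computes.Proj)
next
  case (Comp f gs)
  from Comp.prems(1)[OF subprograms_self Comp.prems(2)] obtain ys where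
    ys: "list_all2 (\<lambda>g. R g xs) gs ys" "R f ys y" by auto
  have len: "length ys = length gs" using ys(1) by (simp add: list_all2_lengthD)
  have "computes f ys y"
    by (rule Comp.IH(1)) (use Comp.prems(1) ys len in auto)
  moreover have "list_all2 (\<lambda>g. computes g xs) gs ys"
    using ys(1)
  proof (rule list.rel_mono_strong)
    fix g w assume "g \<in> set gs" "R g xs w"
    then show "computes g xs w" by (intro Comp.IH(2)) (use Comp.prems(1) in auto)
  qed
  ultimately show ?case by (rule computes.Comp[rotated])
next
  case (Prec f g)
  \<comment> \<open>A \<open>Prec\<close> fact may rest on another fact of the same program, hence
    an inner induction on the recursion argument. The number of arguments stays
    \<open>Suc n\<close>, so justification remains available.\<close>
  have len: "length xs = Suc n \<Longrightarrow> R (Prec f g) zs w \<Longrightarrow> length zs = Suc n \<Longrightarrow> computes (Prec f g) zs w"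
    for n zs w
  proof (induction "hd zs" arbitrary: zs w)
    case 0
    then have "justified R (Prec f g) zs w" by (intro Prec.prems(1)) auto
    with 0 obtain ns where ns: "zs = 0 # ns" "R f ns w" by auto
    have "computes f ns w"
      by (rule Prec.IH(1)) (use Prec.prems(1) ns 0 in auto)
    then show ?case using ns by (auto intro: computes.Prec_0)
  next
    case (Suc m)
    then have "justified R (Prec f g) zs w" by (intro Prec.prems(1)) auto
    with Suc obtain ns r where ns: "zs = Suc m # ns" "R (Prec f g) (m # ns) r" "R g (m # r # ns) w"
      by auto
    have "length ns = n" using Suc.prems(3) ns(1) by simp
    have "computes (Prec f g) (m # ns) r"
      by (rule Suc.hyps) (use Suc ns in auto)
    moreover have "computes g (m # r # ns) w"
      by (rule Prec.IH(2)) (use Prec.prems(1) ns \<open>length ns = n\<close> Suc.prems(1) in auto)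
    ultimately show ?case using ns by (auto intro: computes.Prec_Suc)
  qed
  from Prec.prems(1)[OF subprograms_self Prec.prems(2)] obtain n ns where "xs = n # ns" by auto
  then show ?case using len Prec.prems(2) by simp
next
  case (Mu f)
  from Mu.prems(1)[OF subprograms_self Mu.prems(2)] have
    "R f (y # xs) 0" "\<forall>i<y. \<exists>w>0. R f (i # xs) w" by auto
  moreover have "R f (i # xs) w \<Longrightarrow> computes f (i # xs) w" for i w
    by (rule Mu.IH) (use Mu.prems(1) in auto)
  ultimately show ?case by (blast intro: computes.Mu)
qed

definition closed_facts :: "(recf \<times> nat list \<times> nat) set \<Rightarrow> bool" where
  "closed_facts F \<longleftrightarrow> (\<forall>(f, xs, y)\<in>F. justified (\<lambda>f xs y. (f, xs, y) \<in> F) f xs y)"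

lemma closed_facts_UN:
  assumes "\<And>i. i \<in> I \<Longrightarrow> closed_facts (F i)"
  shows "closed_facts (\<Union>i\<in>I. F i)"
  unfolding closed_facts_def
proof clarify
  fix f xs y i assume i: "i \<in> I" "(f, xs, y) \<in> F i"
  then have "justified (\<lambda>f xs y. (f, xs, y) \<in> F i) f xs y"
    using assms unfolding closed_facts_def by blast
  then show "justified (\<lambda>f xs y. (f, xs, y) \<in> (\<Union>i\<in>I. F i)) f xs y"
    by (rule justified_mono) (use i in auto)
qed

lemma closed_facts_insert:
  assumes "closed_facts F" "justified (\<lambda>f xs y. (f, xs, y) \<in> F) f xs y"
  shows "closed_facts (insert (f, xs, y) F)"
  using assms unfolding closed_facts_def by (auto intro: justified_mono)

definition derivable :: "recf \<Rightarrow> nat list \<Rightarrow> nat \<Rightarrow> bool" where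
  "derivable f xs y \<longleftrightarrow> (\<exists>F. finite F \<and> closed_facts F \<and> (f, xs, y) \<in> F)"

text \<open>One derivation is chosen for each premise in \<open>G\<close>. Their union with the
  conclusion is again closed, and it is finite since \<open>G\<close> is.\<close>

lemma derivable_finite:
  assumes "finite G" "\<And>f xs y. (f, xs, y) \<in> G \<Longrightarrow> derivable f xs y"
    and "justified (\<lambda>f xs y. (f, xs, y) \<in> G) f xs y"
  shows "derivable f xs y"
proof -
  have "\<forall>g\<in>G. \<exists>F. finite F \<and> closed_facts F \<and> g \<in> F"
    using assms(2) by (force simp: derivable_def)
  then obtain F where F: "\<And>g. g \<in> G \<Longrightarrow> finite (F g) \<and> closed_facts (F g) \<and> g \<in> F g" by metis
  let ?U = "\<Union>g\<in>G. F g"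
  have "closed_facts (insert (f, xs, y) ?U)"
    by (intro closed_facts_insert closed_facts_UN justified_mono[OF assms(3)]) (use F in auto)
  moreover have "finite (insert (f, xs, y) ?U)" using assms(1) F by auto
  ultimately show ?thesis unfolding derivable_def by blast
qed

lemma derivable_if_computes: "computes f xs y \<Longrightarrow> derivable f xs y"
proof (induction rule: computes.induct)
  case (Zero xs)
  show ?case by (rule derivable_finite[of "{}"]) auto
next
  case (Succ x)
  show ?case by (rule derivable_finite[of "{}"]) auto
next
  case (Proj i xs)
  show ?case by (rule derivable_finite[of "{}"]) (use Proj in auto)
next
  case (Comp xs gs ys f z)
  let ?G = "insert (f, ys, z) ((\<lambda>(g, y). (g, xs, y)) ` set (zip gs ys))"
  show ?case
  proof (rule derivable_finite[of ?G])
    show "justified (\<lambda>f xs y. (f, xs, y) \<in> ?G) (Comp f gs) xs z"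
      using Comp.IH by (auto simp: list_all2_iff image_iff intro!: exI[of _ ys])
  qed (use Comp.IH in \<open>auto simp: list_all2_iff\<close>)
next
  case (Prec_0 f xs y g)
  show ?case by (rule derivable_finite[of "{(f, xs, y)}"]) (use Prec_0 in auto)
next
  case (Prec_Suc f g n xs r y)
  show ?case
    by (rule derivable_finite[of "{(Prec f g, n # xs, r), (g, n # r # xs, y)}"])
      (use Prec_Suc in auto)
next
  case (Mu f n xs)
  \<comment> \<open>Fixing one value \<open>w i\<close> for each \<open>i < n\<close> keeps the set
    of premises finite.\<close>
  then obtain w where w: "\<And>i. i < n \<Longrightarrow> w i > 0 \<and> derivable f (i # xs) (w i)" by metis
  show ?case
    by (rule derivable_finite[of "insert (f, n # xs, 0) ((\<lambda>i. (f, i # xs, w i)) ` {..<n})"])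
      (use w Mu.IH in auto)
qed

section \<open>Points on lines of a linearly regular flat\<close>

lemma betw_iff_between: "betw s t u \<longleftrightarrow> between (s, u) t"
  by (simp add: betw_def between)

lemma betw_iff_convex_comb:
  "betw s t u \<longleftrightarrow> (\<exists>l. 0 \<le> l \<and> l \<le> 1 \<and> t = (1 - l) *\<^sub>R s + l *\<^sub>R u)"
  by (auto simp: betw_iff_between between_mem_segment closed_segment_def)

text \<open>Distances on the ray are coordinate differences times \<open>norm u\<close>. Betweenness
  from a first point is thus the order of coordinates, which lets \<open>betw\<close> compare
  numbers.\<close>

lemma betw_on_ray:
  assumes "u \<noteq> 0" "a \<le> b" "a \<le> c"
  shows "betw (x + a *\<^sub>R u) (x + b *\<^sub>R u) (x + c *\<^sub>R u) \<longleftrightarrow> b \<le> c"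
proof -
  have "dist (x + r *\<^sub>R u) (x + s *\<^sub>R u) = \<bar>r - s\<bar> * norm u" for r s
    by (simp add: dist_norm flip: scaleR_diff_left)
  then have "betw (x + a *\<^sub>R u) (x + b *\<^sub>R u) (x + c *\<^sub>R u) \<longleftrightarrow>
      \<bar>a - c\<bar> * norm u = (\<bar>a - b\<bar> + \<bar>b - c\<bar>) * norm u"
    by (simp add: betw_def distrib_right)
  also have "\<dots> \<longleftrightarrow> b \<le> c" using assms by auto
  finally show ?thesis .
qed

lemma betw_on_line:
  assumes "a \<le> b" "b \<le> c"
  shows "betw (x + a *\<^sub>R u) (x + b *\<^sub>R u) (x + c *\<^sub>R u)"
  using assms betw_on_ray[of u a b c x] by (cases "u = 0") (auto simp: betw_def)

lemma collin_on_line: "collin (x + a *\<^sub>R u) (x + b *\<^sub>R u) (x + c *\<^sub>R u)"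
proof -
  have sym: "betw r s t \<longleftrightarrow> betw t s r" for r s t :: "real^'n"
    by (auto simp: betw_def dist_commute)
  consider "a \<le> b" "b \<le> c" | "a \<le> c" "c \<le> b" | "b \<le> a" "a \<le> c"
    | "c \<le> b" "b \<le> a" | "b \<le> c" "c \<le> a" | "c \<le> a" "a \<le> b" by linarith
  then show ?thesis
    unfolding collin_def by cases (use betw_on_line[of _ _ _ x u] sym in blast)+
qed

section \<open>Euclidean lines and their traces on a linearly regular flat\<close>

definition eline :: "real^'n \<Rightarrow> real^'n \<Rightarrow> (real^'n) set" where
  "eline x u = {x + r *\<^sub>R u | r. True}"

lemma flat_1_eline:
  assumes "u \<noteq> 0"
  shows "flat 1 (eline x u)"
proof -
  have "eline x u = {x + (\<Sum>i<1. r i *\<^sub>R u) | r :: nat \<Rightarrow> real. True}"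
    unfolding eline_def by (auto intro: exI[of _ "\<lambda>_::nat. s" for s])
  moreover have "inj_on (\<lambda>_::nat. u) {..<1}" "independent ((\<lambda>_::nat. u) ` {..<1})"
    using assms by (auto simp: lessThan_Suc)
  ultimately show ?thesis unfolding flat_def by blast
qed

text \<open>Makes the density clause applicable to any two points of \<open>S\<close>. The trace is
  closed under betweenness because the third point is an affine combination of the other
  two.\<close>

lemma line_in_eline:
  assumes "x \<in> S" "x + u \<in> S" "u \<noteq> 0"
  shows "line_in S (S \<inter> eline x u)"
proof -
  have in_eline: "w \<in> eline x u \<longleftrightarrow> (\<exists>r. w = x + r *\<^sub>R u)" for w by (auto simp: eline_def)
  have closed: "w \<in> eline x u"
    if st: "s \<in> eline x u" "t \<in> eline x u" "s \<noteq> t" and b: "betw s w t \<or> betw s t w" for s t w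
  proof -
    obtain a b where ab: "s = x + a *\<^sub>R u" "t = x + b *\<^sub>R u" using st by (auto simp: in_eline)
    from b show ?thesis
    proof
      assume "betw s w t"
      then obtain l where "w = (1 - l) *\<^sub>R s + l *\<^sub>R t" by (auto simp: betw_iff_convex_comb)
      then have "w = x + ((1 - l) * a + l * b) *\<^sub>R u"
        unfolding ab by (simp add: algebra_simps)
      then show ?thesis unfolding in_eline by blast
    next
      assume "betw s t w"
      then obtain l where l: "t = (1 - l) *\<^sub>R s + l *\<^sub>R w" by (auto simp: betw_iff_convex_comb)
      \<comment> \<open>\<open>l = 0\<close> would mean \<open>t = s\<close>. Dividing by
        \<open>l\<close> then expresses \<open>w\<close> by \<open>s\<close> and
        \<open>t\<close>.\<close>
      with st(3) have "l \<noteq> 0" by auto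
      have "l *\<^sub>R w = t - (1 - l) *\<^sub>R s" using l by simp
      also have "\<dots> = l *\<^sub>R x + (b - (1 - l) * a) *\<^sub>R u"
        unfolding ab by (simp add: algebra_simps)
      also have "b - (1 - l) * a = l * (a + (b - a) / l)"
        using \<open>l \<noteq> 0\<close> by (simp add: field_simps)
      also have "l *\<^sub>R x + (l * (a + (b - a) / l)) *\<^sub>R u = l *\<^sub>R (x + (a + (b - a) / l) *\<^sub>R u)"
        by (simp only: scaleR_add_right scaleR_scaleR)
      finally have "w = x + (a + (b - a) / l) *\<^sub>R u" using \<open>l \<noteq> 0\<close> by simp
      then show ?thesis unfolding in_eline by blast
    qed
  qed
  show ?thesis
    unfolding line_in_def
  proof (intro conjI ballI impI)
    show "\<exists>s\<in>S \<inter> eline x u. \<exists>t\<in>S \<inter> eline x u. s \<noteq> t"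
    proof (intro bexI)
      show "x \<noteq> x + u" using assms by simp
      show "x + u \<in> S \<inter> eline x u" "x \<in> S \<inter> eline x u"
        using assms exI[of "\<lambda>r. x = x + r *\<^sub>R u" 0] exI[of "\<lambda>r. x + u = x + r *\<^sub>R u" 1]
        by (simp_all add: in_eline)
    qed
    fix s t w
    assume st: "s \<in> S \<inter> eline x u" "t \<in> S \<inter> eline x u"
    show "collin s t w" if "w \<in> S \<inter> eline x u"
      using st that by (auto simp: in_eline collin_on_line)
    show "w \<in> S \<inter> eline x u" if "w \<in> S" "s \<noteq> t \<and> (betw s w t \<or> betw s t w)"
      using closed[of s t w] st that by simp
  qed simp
qed

text \<open>The density clause is applied at the midpoint of the interval, with half its length,
  scaled by \<open>norm u\<close>, as radius.\<close>

lemma regular_flat_dense: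
  assumes "linearly_regular_flat m S" "x \<in> S" "x + u \<in> S" "u \<noteq> 0" "a < b"
  shows "\<exists>r. a < r \<and> r < b \<and> x + r *\<^sub>R u \<in> S"
proof -
  define mid where "mid = (a + b) / 2"
  have "\<forall>L L'. line_in S L \<and> flat 1 L' \<and> L \<subseteq> L' \<longrightarrow>
      (\<forall>r\<in>L'. \<forall>\<epsilon>>0. \<exists>s\<in>L. dist s r < \<epsilon>)"
    using assms(1) unfolding linearly_regular_flat_def by (elim conjE)
  then have "\<forall>r\<in>eline x u. \<forall>\<epsilon>>0. \<exists>s\<in>S \<inter> eline x u. dist s r < \<epsilon>"
    using assms line_in_eline[of x S u] flat_1_eline[of u x] by (metis Int_lower2)
  moreover have "x + mid *\<^sub>R u \<in> eline x u" by (auto simp: eline_def)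
  moreover have "(b - a) / 2 * norm u > 0" using assms by simp
  ultimately obtain s where s: "s \<in> S \<inter> eline x u" "dist s (x + mid *\<^sub>R u) < (b - a) / 2 * norm u"
    by blast
  then obtain r where r: "s = x + r *\<^sub>R u" by (auto simp: eline_def)
  have "\<bar>r - mid\<bar> * norm u < (b - a) / 2 * norm u"
    using s(2) by (simp add: r dist_norm flip: scaleR_diff_left)
  then have "\<bar>r - mid\<bar> < (b - a) / 2" using assms by simp
  then have "a < r \<and> r < b" unfolding mid_def abs_less_iff by (simp add: field_simps)
  then show ?thesis using s r by auto
qed

text \<open>There is no largest element, as density applies again between any element and
  \<open>b\<close>.\<close>

lemma regular_flat_dense_infinite:
  assumes "linearly_regular_flat m S" "x \<in> S" "x + u \<in> S" "u \<noteq> 0" "a < b"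
  shows "infinite {r. a < r \<and> r < b \<and> x + r *\<^sub>R u \<in> S}"
proof (rule infinite_growing)
  show "{r. a < r \<and> r < b \<and> x + r *\<^sub>R u \<in> S} \<noteq> {}"
    using regular_flat_dense[OF assms] by blast
  fix r assume r: "r \<in> {r. a < r \<and> r < b \<and> x + r *\<^sub>R u \<in> S}"
  then obtain s where "r < s" "s < b" "x + s *\<^sub>R u \<in> S"
    using regular_flat_dense[OF assms(1-4), of r b] by auto
  with r show "\<exists>s\<in>{r. a < r \<and> r < b \<and> x + r *\<^sub>R u \<in> S}. r < s"
    by (intro bexI[of _ s]) auto
qed

text \<open>Dependent choice: density between the last term and \<delta> always supplies a larger
  term.\<close>

lemma regular_flat_sequence:
  assumes "linearly_regular_flat m S" "x \<in> S" "x + u \<in> S" "u \<noteq> 0" "\<delta> > 0"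
  shows "\<exists>r :: nat \<Rightarrow> real. strict_mono r \<and> (\<forall>i. 0 < r i \<and> r i < \<delta> \<and> x + r i *\<^sub>R u \<in> S)"
proof -
  define A where "A = (\<lambda>s. 0 < s \<and> s < \<delta> \<and> x + s *\<^sub>R u \<in> S)"
  have ex: "\<exists>r. A r" using regular_flat_dense[OF assms] by (auto simp: A_def)
  have "\<exists>s. A s \<and> r < s" if r: "A r" for r
  proof -
    obtain s where "r < s" "s < \<delta>" "x + s *\<^sub>R u \<in> S"
      using regular_flat_dense[OF assms(1-4), of r \<delta>] r by (auto simp: A_def)
    then show ?thesis using r by (intro exI[of _ s]) (auto simp: A_def)
  qed
  with ex have "\<exists>r. \<forall>n. A (r n) \<and> r n < r (Suc n)"
    by (intro dependent_nat_choice) auto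
  then show ?thesis by (auto simp: A_def strict_mono_Suc_iff)
qed

text \<open>\<open>S\<close> is contained in no Euclidean line, so some point lies off the line
  through \<open>x\<close> and another point. The last conclusion states the independence of
  \<open>u\<close> and \<open>w\<close> as uniqueness of coordinates.\<close>

lemma regular_flat_not_collinear:
  fixes x :: "real^'n"
  assumes "linearly_regular_flat 2 S" "x \<in> S"
  obtains u w where "x + u \<in> S" "x + w \<in> S" "u \<noteq> 0" "w \<noteq> 0"
    "\<And>a b a' b'. a *\<^sub>R u + b *\<^sub>R w = a' *\<^sub>R u + b' *\<^sub>R w \<Longrightarrow> a = a' \<and> b = b'"
proof -
  have "\<not> (\<exists>F. flat 1 F \<and> S \<subseteq> F)"
    using assms(1) by (simp add: linearly_regular_flat_def)
  then have no_line: "\<not> S \<subseteq> eline x u" if "u \<noteq> 0" for u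
    using flat_1_eline[OF that, of x] by blast
  \<comment> \<open>The direction \<open>e\<close> is arbitrary: a point \<open>p\<close> off some
    line through \<open>x\<close> differs from \<open>x\<close>.\<close>
  obtain e :: "real^'n" where "e \<noteq> 0" using nonzero_Basis by blast
  with no_line obtain p where p: "p \<in> S" "p \<notin> eline x e" by blast
  define u where "u = p - x"
  have "u \<noteq> 0" using p by (auto simp: u_def eline_def)
  with no_line obtain q where q: "q \<in> S" "q \<notin> eline x u" by blast
  define w where "w = q - x"
  have w: "w \<noteq> r *\<^sub>R u" for r using q(2) by (auto simp: w_def eline_def algebra_simps)
  show thesis
  proof
    show "x + u \<in> S" "x + w \<in> S" using p q by (simp_all add: u_def w_def)
    show "u \<noteq> 0" by fact
    show "w \<noteq> 0" using w[of 0] by simp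
    fix a b a' b' assume "a *\<^sub>R u + b *\<^sub>R w = a' *\<^sub>R u + b' *\<^sub>R w"
    then have eq: "(b - b') *\<^sub>R w = (a' - a) *\<^sub>R u" by (simp add: algebra_simps)
    have "b = b'"
    proof (rule ccontr)
      assume "b \<noteq> b'"
      then have "w = (1 / (b - b')) *\<^sub>R (b - b') *\<^sub>R w" by simp
      also have "\<dots> = ((a' - a) / (b - b')) *\<^sub>R u" unfolding eq by simp
      finally show False using w by blast
    qed
    with eq \<open>u \<noteq> 0\<close> show "a = a' \<and> b = b'" by simp
  qed
qed

text \<open>\<open>num\<close> and \<open>t\<close> run along two rays from \<open>x\<close>, and
  \<open>c j i\<close> is the link between \<open>t j\<close> and \<open>num i\<close>. The bounds
  \<open>K\<close> and \<open>M\<close> leave only finitely many segments to be avoided.\<close>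

lemma incidence_configuration:
  fixes T :: "(real^'n) set"
  assumes "extends_linearly 2 T"
  obtains num t :: "nat \<Rightarrow> real^'n" and c :: "nat \<Rightarrow> nat \<Rightarrow> real^'n" where
    "range num \<subseteq> T" "range t \<subseteq> T" "\<And>j i. j < K \<Longrightarrow> i < M \<Longrightarrow> c j i \<in> T"
    "inj num" "inj t"
    "\<And>i i'. betw (num 0) (num i) (num i') \<longleftrightarrow> i \<le> i'"
    "\<And>j i j' i'. j < K \<Longrightarrow> i < M \<Longrightarrow> j' < K \<Longrightarrow> i' < M \<Longrightarrow>
      betw (t j') (c j i) (num i') \<longleftrightarrow> j = j' \<and> i = i'"
proof -
  obtain S \<epsilon> x where S: "linearly_regular_flat 2 S" "x \<in> S" "\<epsilon> > 0"
    and sub: "{u \<in> S. dist x u < \<epsilon>} \<subseteq> T"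
    using assms by (auto simp: extends_linearly_def)
  obtain u w where uw: "x + u \<in> S" "x + w \<in> S" "u \<noteq> 0" "w \<noteq> 0"
    and ind: "\<And>a b a' b'. a *\<^sub>R u + b *\<^sub>R w = a' *\<^sub>R u + b' *\<^sub>R w \<Longrightarrow> a = a' \<and> b = b'"
    using regular_flat_not_collinear[OF S(1,2)] by metis
  \<comment> \<open>The bound \<open>\<epsilon> / norm u\<close> on the coordinates keeps the points
    within distance \<epsilon> of \<open>x\<close>.\<close>
  obtain s where s: "strict_mono s" "\<And>i::nat. 0 < s i \<and> s i < \<epsilon> / norm u \<and> x + s i *\<^sub>R u \<in> S"
    using regular_flat_sequence[OF S(1,2) uw(1,3), of "\<epsilon> / norm u"] S(3) uw(3) by auto
  obtain r where r: "strict_mono r" "\<And>i::nat. 0 < r i \<and> r i < \<epsilon> / norm w \<and> x + r i *\<^sub>R w \<in> S"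
    using regular_flat_sequence[OF S(1,2) uw(2,4), of "\<epsilon> / norm w"] S(3) uw(4) by auto
  define num t where "num i = x + s i *\<^sub>R u" and "t i = x + r i *\<^sub>R w" for i
  have num: "num i \<in> S" "num i \<in> ball x \<epsilon>" and t: "t i \<in> S" "t i \<in> ball x \<epsilon>" for i
    using s(2)[of i] r(2)[of i] uw(3,4) by (auto simp: num_def t_def dist_norm field_simps)
  have ne: "num i \<noteq> t j" for i j
    using ind[of "s i" 0 0 "r j"] s(2)[of i] by (auto simp: num_def t_def)
  \<comment> \<open>Balls are convex, so points of \<open>S\<close> on a segment between chosen
    points are again in \<open>T\<close>.\<close>
  have seg: "c \<in> T" if "c \<in> S" "betw (t j) c (num i)" for c i j
  proof -
    have "c \<in> closed_segment (t j) (num i)"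
      using that by (simp add: betw_iff_between between_mem_segment)
    also have "\<dots> \<subseteq> ball x \<epsilon>" using num t by (intro closed_segment_subset) auto
    finally show ?thesis using sub that(1) by auto
  qed
  have "\<exists>c. c \<in> S \<and> (\<forall>j'<K. \<forall>i'<M. betw (t j') c (num i') \<longleftrightarrow> j = j' \<and> i = i')" for j i
  proof -
    define v where "v = num i - t j"
    define \<Lambda> where "\<Lambda> = {l. 0 < l \<and> l < 1 \<and> t j + l *\<^sub>R v \<in> S}"
    define bad where "bad = (\<lambda>(j', i'). {l. betw (t j') (t j + l *\<^sub>R v) (num i')})"
    have "infinite \<Lambda>" unfolding \<Lambda>_def
      by (rule regular_flat_dense_infinite[OF S(1)]) (use num t ne in \<open>auto simp: v_def\<close>)
    moreover have "finite (bad (j', i'))" if "(j', i') \<noteq> (j, i)" for j' i'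
    proof -
      \<comment> \<open>Comparing coordinates gives \<open>k\<close> and \<open>1 - k\<close> as
        multiples of \<open>l\<close> and \<open>1 - l\<close>; their sum eliminates
        \<open>k\<close>.\<close>
      have root: "(1 - l) * (r j / r j') + l * (s i / s i') = 1"
        if "l \<in> bad (j', i')" for l
      proof -
        from that obtain k where "t j + l *\<^sub>R v = (1 - k) *\<^sub>R t j' + k *\<^sub>R num i'"
          by (auto simp: bad_def betw_iff_convex_comb)
        then have "(l * s i) *\<^sub>R u + ((1 - l) * r j) *\<^sub>R w = (k * s i') *\<^sub>R u + ((1 - k) * r j') *\<^sub>R w"
          by (simp add: v_def num_def t_def algebra_simps)
        then have "l * s i = k * s i'" "(1 - l) * r j = (1 - k) * r j'"
          using ind by blast+
        then show ?thesis using s(2)[of i'] r(2)[of j'] by (simp add: field_simps)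
      qed
      \<comment> \<open>The equation is affine in \<open>l\<close>. Two solutions would force both
        quotients to be 1, hence the same segment.\<close>
      have "l = l'" if "l \<in> bad (j', i')" "l' \<in> bad (j', i')" for l l'
      proof (rule ccontr)
        assume "l \<noteq> l'"
        define p q where "p = r j / r j'" and "q = s i / s i'"
        have eqs: "(1 - l) * p + l * q = 1" "(1 - l') * p + l' * q = 1"
          using root that by (simp_all add: p_def q_def)
        then have "(l - l') * (q - p) = 0" by (simp add: algebra_simps)
        then have "q = p" using \<open>l \<noteq> l'\<close> by simp
        with eqs have "p = 1" "q = 1" by (simp_all add: algebra_simps)
        then have "r j = r j'" "s i = s i'"
          using s(2)[of i'] r(2)[of j'] by (simp_all add: p_def q_def)
        then show False
          using \<open>(j', i') \<noteq> (j, i)\<close> s(1) r(1) by (auto simp: strict_mono_eq)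
      qed
      then show ?thesis
        by (metis finite.emptyI finite.insertI finite_subset insertI1 subsetI)
    qed
    then have "finite (\<Union>z\<in>{..<K} \<times> {..<M} - {(j, i)}. bad z)" by (intro finite_UN_I) auto
    ultimately obtain l where l: "l \<in> \<Lambda>" "l \<notin> (\<Union>z\<in>{..<K} \<times> {..<M} - {(j, i)}. bad z)"
      by (metis finite_subset subsetI)
    have "betw (t j) (t j + l *\<^sub>R v) (num i)"
      unfolding betw_iff_convex_comb
      by (rule exI[of _ l]) (use l in \<open>auto simp: \<Lambda>_def v_def algebra_simps\<close>)
    then show ?thesis
      using l by (intro exI[of _ "t j + l *\<^sub>R v"]) (auto simp: \<Lambda>_def bad_def)
  qed
  then obtain c where c: "\<And>j i. c j i \<in> S"
    "\<And>j i j' i'. j' < K \<Longrightarrow> i' < M \<Longrightarrow> betw (t j') (c j i) (num i') \<longleftrightarrow> j = j' \<and> i = i'" by metis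
  show thesis
  proof
    show "range num \<subseteq> T" "range t \<subseteq> T" using num t sub by auto
    show "c j i \<in> T" if "j < K" "i < M" for j i
      using c(1) by (rule seg) (use c(2) that in blast)
    show "inj num" "inj t"
      using uw s(1) r(1) by (auto simp: inj_def num_def t_def strict_mono_eq)
    show "betw (num 0) (num i) (num i') \<longleftrightarrow> i \<le> i'" for i i'
      unfolding num_def
      by (subst betw_on_ray) (use uw s(1) in \<open>auto simp: strict_mono_less_eq\<close>)
  qed (use c(2) in auto)
qed

section \<open>The sentences\<close>

text \<open>Countability provides \<open>to_nat\<close>, which gives each role its own set
  variable.\<close>

instance recf :: countable by countable_datatype

datatype role = Number | Link nat | Fact recf nat

instance role :: countable by countable_datatype

text \<open>\<open>Number\<close>, \<open>Fact f a\<close> and \<open>Link i\<close> name the set variables for the points that represent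
  numbers, for the points that represent facts \<open>(f, xs, y)\<close> with \<open>length xs = a\<close>, and for the points
  that lie between a fact and the \<open>i\<close>-th entry of \<open>y # xs\<close>.\<close>

abbreviation mem :: "role \<Rightarrow> nat \<Rightarrow> fm" where
  "mem s x \<equiv> Mem (to_nat s) x"

abbreviation verum :: fm where
  "verum \<equiv> Neg (Ex 0 (Neg (Eq 0 0)))"

abbreviation disj :: "fm \<Rightarrow> fm \<Rightarrow> fm" where
  "disj \<phi> \<psi> \<equiv> Neg (Conj (Neg \<phi>) (Neg \<psi>))"

abbreviation imp :: "fm \<Rightarrow> fm \<Rightarrow> fm" where
  "imp \<phi> \<psi> \<equiv> Neg (Conj \<phi> (Neg \<psi>))"

primrec conjs :: "fm list \<Rightarrow> fm" where
  "conjs [] = verum"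
| "conjs (\<phi> # \<phi>s) = Conj \<phi> (conjs \<phi>s)"

definition ex_num :: "nat \<Rightarrow> fm \<Rightarrow> fm" where
  "ex_num x \<phi> = Ex x (Conj (mem Number x) \<phi>)"

abbreviation all_num :: "nat \<Rightarrow> fm \<Rightarrow> fm" where
  "all_num x \<phi> \<equiv> Neg (ex_num x (Neg \<phi>))"

primrec ex_nums :: "nat \<Rightarrow> nat \<Rightarrow> fm \<Rightarrow> fm" where
  "ex_nums x 0 \<phi> = \<phi>"
| "ex_nums x (Suc m) \<phi> = ex_num x (ex_nums (Suc x) m \<phi>)"

text \<open>Throughout, variable 2 denotes the number zero; 3 and \<open>4, \<dots>, 3 + a\<close> denote the result and the
  arguments of a fact. Variables 0 and 1 are only used for auxiliary quantifiers.\<close>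

definition less_fm :: "nat \<Rightarrow> nat \<Rightarrow> fm" where
  "less_fm x y = Conj (Bet 2 x y) (Neg (Eq x y))"

definition succ_fm :: "nat \<Rightarrow> nat \<Rightarrow> fm" where
  "succ_fm x y = Conj (less_fm x y) (Neg (ex_num 0 (Conj (less_fm x 0) (less_fm 0 y))))"

definition fact_fm :: "recf \<Rightarrow> nat list \<Rightarrow> nat \<Rightarrow> fm" where
  "fact_fm f xs y = Ex 0 (Conj (mem (Fact f (length xs)) 0)
     (conjs (map (\<lambda>i. Ex 1 (Conj (mem (Link i) 1) (Bet 0 1 ((y # xs) ! i)))) [0..<Suc (length xs)])))"

text \<open>Follows \<open>justified\<close> clause by clause. Program and arity are known when the
  formula is built, so a violated condition on the arity becomes \<open>Neg verum\<close>. Further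
  numbers that a rule quantifies over get variables from \<open>4 + a\<close> on.\<close>

fun justified_fm :: "recf \<Rightarrow> nat \<Rightarrow> fm" where
  "justified_fm Zero a = Eq 3 2"
| "justified_fm Succ a = (if a = 1 then succ_fm 4 3 else Neg verum)"
| "justified_fm (Proj i) a = (if i < a then Eq 3 (4 + i) else Neg verum)"
| "justified_fm (Comp f gs) a = ex_nums (4 + a) (length gs) (Conj
     (conjs (map (\<lambda>i. fact_fm (gs ! i) [4..<4 + a] (4 + a + i)) [0..<length gs]))
     (fact_fm f [4 + a..<4 + a + length gs] 3))"
| "justified_fm (Prec f g) a = (if a = 0 then Neg verum else
     disj (Conj (Eq 4 2) (fact_fm f [5..<4 + a] 3))
       (ex_num (4 + a) (ex_num (5 + a) (Conj (succ_fm (4 + a) 4) (Conj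
         (fact_fm (Prec f g) ((4 + a) # [5..<4 + a]) (5 + a))
         (fact_fm g ((4 + a) # (5 + a) # [5..<4 + a]) 3))))))"
| "justified_fm (Mu f) a = Conj (fact_fm f (3 # [4..<4 + a]) 2)
     (all_num (4 + a) (imp (less_fm (4 + a) 3)
       (ex_num (5 + a) (Conj (Neg (Eq (5 + a) 2)) (fact_fm f ((4 + a) # [4..<4 + a]) (5 + a))))))"

definition rule_fm :: "recf \<Rightarrow> nat \<Rightarrow> fm" where
  "rule_fm f a = Neg (ex_nums 3 (Suc a) (Neg (imp (fact_fm f [4..<4 + a] 3) (justified_fm f a))))"

text \<open>Comparability as seen from zero. For \<open>betw\<close> this orders the points by their
  distance from zero, without ties.\<close>

definition order_fm :: fm where
  "order_fm = all_num 3 (all_num 4 (disj (Bet 2 3 4) (Bet 2 4 3)))"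

definition result_fm :: "recf \<Rightarrow> fm" where
  "result_fm p = ex_num 4 (fact_fm p [3] 4)"

text \<open>\<open>next_fm \<phi>\<close> says \<open>\<phi>\<close> of the successor of variable 3. The input \<open>e\<close> enters the final sentence as
  the \<open>e\<close>-fold iteration of this fixed operation, hence the code depends computably on \<open>e\<close>.\<close>

definition next_fm :: "fm \<Rightarrow> fm" where
  "next_fm \<phi> = ex_num 4 (Conj (succ_fm 3 4) (Ex 3 (Conj (Eq 3 4) \<phi>)))"

text \<open>Variable 3 starts as zero and the iterated \<open>next_fm\<close> moves it to
  \<open>e\<close>, so \<open>result_fm\<close> asks for a result on input \<open>e\<close>.\<close>

definition body_fm :: "recf \<Rightarrow> nat \<Rightarrow> fm" where
  "body_fm p e = Conj (conjs (map (\<lambda>(f, a). rule_fm f a) (subprograms p 1)))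
     (Ex 3 (Conj (Eq 3 2) ((next_fm ^^ e) (result_fm p))))"

definition halting_fm :: "recf \<Rightarrow> nat \<Rightarrow> fm" where
  "halting_fm p e = ex_num 2 (Conj order_fm (body_fm p e))"

section \<open>Free variables of the sentences\<close>

lemma fo_vars_conjs [simp]: "fo_vars (conjs \<phi>s) = (\<Union>\<phi>\<in>set \<phi>s. fo_vars \<phi>)"
  by (induction \<phi>s) auto

lemma fo_vars_ex_num [simp]: "fo_vars (ex_num x \<phi>) = fo_vars \<phi> - {x}"
  by (auto simp: ex_num_def)

lemma fo_vars_ex_nums [simp]: "fo_vars (ex_nums x m \<phi>) = fo_vars \<phi> - {x..<x + m}"
  by (induction m arbitrary: x) auto

lemma fo_vars_less_fm [simp]: "fo_vars (less_fm x y) = {2, x, y}"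
  by (auto simp: less_fm_def)

lemma fo_vars_succ_fm: "fo_vars (succ_fm x y) \<subseteq> {2, x, y}"
  by (auto simp: succ_fm_def)

lemma fo_vars_fact_fm: "fo_vars (fact_fm f xs y) \<subseteq> insert y (set xs)"
proof -
  have "(y # xs) ! i \<in> insert y (set xs)" if "i < Suc (length xs)" for i
    using nth_mem[of i "y # xs"] that by simp
  then show ?thesis by (fastforce simp: fact_fm_def simp del: upt_Suc)
qed

lemma fo_vars_justified_fm: "fo_vars (justified_fm f a) \<subseteq> {2..<4 + a}"
proof (cases f)
  case (Comp g gs)
  have "fo_vars (fact_fm g' [4..<4 + a] (4 + a + i)) - {4 + a..<4 + a + length gs} \<subseteq> {2..<4 + a}"
    if "i < length gs" for g' i
    using fo_vars_fact_fm[of g' "[4..<4 + a]" "4 + a + i"] that by auto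
  moreover have "fo_vars (fact_fm g [4 + a..<4 + a + length gs] 3)
      - {4 + a..<4 + a + length gs} \<subseteq> {2..<4 + a}"
    using fo_vars_fact_fm[of g "[4 + a..<4 + a + length gs]" 3] by auto
  ultimately show ?thesis unfolding Comp by (auto simp: subset_iff)
next
  case (Prec g h)
  show ?thesis
    using fo_vars_fact_fm[of g "[5..<4 + a]" 3] fo_vars_succ_fm[of "4 + a" 4]
      fo_vars_fact_fm[of "Prec g h" "(4 + a) # [5..<4 + a]" "5 + a"]
      fo_vars_fact_fm[of h "(4 + a) # (5 + a) # [5..<4 + a]" 3]
    by (auto simp: Prec subset_iff)
next
  case (Mu g)
  show ?thesis
    using fo_vars_fact_fm[of g "3 # [4..<4 + a]" 2]
      fo_vars_fact_fm[of g "(4 + a) # [4..<4 + a]" "5 + a"]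
    by (auto simp: Mu subset_iff)
qed (use fo_vars_succ_fm[of 4 3] in auto)

lemma fo_vars_rule_fm: "fo_vars (rule_fm f a) \<subseteq> {2}"
proof -
  have "fo_vars (fact_fm f [4..<4 + a] 3) \<subseteq> {2..<4 + a}"
    using fo_vars_fact_fm[of f "[4..<4 + a]" 3] by auto
  then show ?thesis using fo_vars_justified_fm[of f a] by (force simp: rule_fm_def)
qed

lemma fo_vars_next_fm_power: "fo_vars ((next_fm ^^ e) (result_fm p)) \<subseteq> {2, 3}"
proof (induction e)
  case 0
  show ?case using fo_vars_fact_fm[of p "[3]" 4] by (auto simp: result_fm_def)
next
  case (Suc e)
  then show ?case using fo_vars_succ_fm[of 3 4] by (auto simp: next_fm_def)
qed

lemma fo_vars_body_fm: "fo_vars (body_fm p e) \<subseteq> {2}"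
  using fo_vars_rule_fm fo_vars_next_fm_power[of e p] by (fastforce simp: body_fm_def)

lemma fo_vars_halting_fm: "fo_vars (halting_fm p e) = {}"
  using fo_vars_body_fm[of p e] by (auto simp: halting_fm_def order_fm_def)

lemma finite_so_vars: "finite (so_vars \<phi>)"
  by (induction \<phi>) auto

text \<open>\<open>next_fm\<close> adds only the variable for \<open>Number\<close>, which occurs
  anyway. Hence the number of set quantifiers can be chosen independently of
  \<open>e\<close>.\<close>

lemma so_vars_halting_fm: "so_vars (halting_fm p e) = so_vars (halting_fm p 0)"
proof -
  have "insert (to_nat Number) (so_vars ((next_fm ^^ e) (result_fm p))) =
      insert (to_nat Number) (so_vars (result_fm p))"
    by (induction e) (auto simp: next_fm_def ex_num_def succ_fm_def less_fm_def)
  then show ?thesis by (auto simp: halting_fm_def ex_num_def body_fm_def)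
qed

lemma sat_conjs [simp]: "sat D B X v (conjs \<phi>s) \<longleftrightarrow> (\<forall>\<phi>\<in>set \<phi>s. sat D B X v \<phi>)"
  by (induction \<phi>s) auto

definition update_from :: "(nat \<Rightarrow> nat) \<Rightarrow> nat \<Rightarrow> nat list \<Rightarrow> nat \<Rightarrow> nat" where
  "update_from k x ns = (\<lambda>i. if x \<le> i \<and> i < x + length ns then ns ! (i - x) else k i)"

lemma update_from_Nil [simp]: "update_from k x [] = k"
  by (auto simp: update_from_def)

lemma update_from_Cons: "update_from k x (n # ns) = update_from (k(x := n)) (Suc x) ns"
  by (auto simp: update_from_def fun_eq_iff nth_Cons')

lemma update_from_before [simp]: "i < x \<Longrightarrow> update_from k x ns i = k i"
  by (simp add: update_from_def)

lemma map_update_from [simp]: "map (update_from k x ns) [x..<x + length ns] = ns"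
  by (auto simp: update_from_def intro: nth_equalityI)

section \<open>Evaluation in a structure with a set of numbers\<close>

text \<open>The common ground of both directions: sets that satisfy the formula yield such an
  enumeration of the numbers, and so does the constructed configuration.\<close>

locale numbered_structure =
  fixes D :: "'a set" and B :: "'a \<Rightarrow> 'a \<Rightarrow> 'a \<Rightarrow> bool" and X :: "nat \<Rightarrow> 'a set"
    and num :: "nat \<Rightarrow> 'a" and M :: nat
  assumes M_pos: "M > 0"
    and numbers: "X (to_nat Number) = num ` {..<M}"
    and numbers_subset: "num ` {..<M} \<subseteq> D"
    and num_inj: "inj_on num {..<M}"
    and order: "\<And>i j. i < M \<Longrightarrow> j < M \<Longrightarrow> B (num 0) (num i) (num j) \<longleftrightarrow> i \<le> j"
begin

definition sats :: "(nat \<Rightarrow> nat) \<Rightarrow> fm \<Rightarrow> bool" where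
  "sats k \<phi> \<longleftrightarrow> sat D B X (\<lambda>x. num (k x)) \<phi>"

lemma num_fun_upd: "(\<lambda>y. num ((k(x := n)) y)) = (\<lambda>y. num (k y))(x := num n)"
  by auto

lemma num_in_D: "i < M \<Longrightarrow> num i \<in> D"
  using numbers_subset by auto

lemma sats_Neg [simp]: "sats k (Neg \<phi>) \<longleftrightarrow> \<not> sats k \<phi>"
  by (simp add: sats_def)

lemma sats_Conj [simp]: "sats k (Conj \<phi> \<psi>) \<longleftrightarrow> sats k \<phi> \<and> sats k \<psi>"
  by (simp add: sats_def)

lemma sats_conjs [simp]: "sats k (conjs \<phi>s) \<longleftrightarrow> (\<forall>\<phi>\<in>set \<phi>s. sats k \<phi>)"
  by (simp add: sats_def)

lemma sats_verum [simp]: "sats k (Ex 0 (Neg (Eq 0 0))) \<longleftrightarrow> False"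
  by (simp add: sats_def)

text \<open>The facts that can be read off the point sets. Entries are bounded by \<open>M\<close>
  because only these numbers are represented; the intersections with \<open>D\<close> mirror the
  range of the quantifiers.\<close>

definition holds :: "recf \<Rightarrow> nat list \<Rightarrow> nat \<Rightarrow> bool" where
  "holds f xs y \<longleftrightarrow> set (y # xs) \<subseteq> {..<M} \<and>
     (\<exists>t\<in>D \<inter> X (to_nat (Fact f (length xs))).
        \<forall>i<Suc (length xs). \<exists>c\<in>D \<inter> X (to_nat (Link i)). B t c (num ((y # xs) ! i)))"

lemma holds_bounds:
  assumes "holds f xs y"
  shows "y < M" "set xs \<subseteq> {..<M}"
  using assms by (auto simp: holds_def)

lemma sats_ex_num [simp]: "sats k (ex_num x \<phi>) \<longleftrightarrow> (\<exists>n<M. sats (k(x := n)) \<phi>)"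
  unfolding sats_def num_fun_upd using numbers_subset by (auto simp: ex_num_def numbers)

lemma sats_let:
  assumes "k y < M" "x \<noteq> y"
  shows "sats k (Ex x (Conj (Eq x y) \<phi>)) \<longleftrightarrow> sats (k(x := k y)) \<phi>"
  unfolding sats_def num_fun_upd using num_in_D[OF assms(1)] assms(2) by auto

lemma sats_ex_nums:
  "sats k (ex_nums x m \<phi>) \<longleftrightarrow>
     (\<exists>ns. length ns = m \<and> set ns \<subseteq> {..<M} \<and> sats (update_from k x ns) \<phi>)"
proof (induction m arbitrary: k x)
  case (Suc m)
  show ?case (is "?L \<longleftrightarrow> ?R")
  proof
    assume ?L
    then obtain n ns where "n < M" "length ns = m" "set ns \<subseteq> {..<M}"
      "sats (update_from (k(x := n)) (Suc x) ns) \<phi>"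
      unfolding ex_nums.simps sats_ex_num Suc.IH by blast
    then show ?R by (intro exI[of _ "n # ns"]) (simp add: update_from_Cons)
  next
    assume ?R
    then obtain n ns where "n < M" "length ns = m" "set ns \<subseteq> {..<M}"
      "sats (update_from k x (n # ns)) \<phi>"
      by (auto simp: length_Suc_conv)
    then show ?L unfolding ex_nums.simps sats_ex_num Suc.IH update_from_Cons by blast
  qed
qed simp

lemma num_eq_iff: "i < M \<Longrightarrow> j < M \<Longrightarrow> num i = num j \<longleftrightarrow> i = j"
  using num_inj by (auto simp: inj_on_def)

definition good :: "(nat \<Rightarrow> nat) \<Rightarrow> bool" where
  "good k \<longleftrightarrow> k 2 = 0 \<and> (\<forall>x. k x < M)"

lemma good_upd: "good k \<Longrightarrow> n < M \<Longrightarrow> x \<noteq> 2 \<Longrightarrow> good (k(x := n))"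
  by (auto simp: good_def)

lemma good_update_from:
  assumes "good k" "set ns \<subseteq> {..<M}" "x > 2"
  shows "good (update_from k x ns)"
  using assms by (auto simp: good_def update_from_def subset_iff)

lemma sats_Eq: "good k \<Longrightarrow> sats k (Eq x y) \<longleftrightarrow> k x = k y"
  by (simp add: sats_def num_eq_iff good_def)

lemma sats_less_fm: "good k \<Longrightarrow> sats k (less_fm x y) \<longleftrightarrow> k x < k y"
  by (auto simp: sats_def less_fm_def num_eq_iff good_def order)

lemma sats_succ_fm:
  assumes "good k" "x > 0" "y > 0"
  shows "sats k (succ_fm x y) \<longleftrightarrow> k y = Suc (k x)"
proof -
  have "sats k (succ_fm x y) \<longleftrightarrow> k x < k y \<and> \<not> (\<exists>n<M. k x < n \<and> n < k y)"
    using assms good_upd[of k _ 0] by (auto simp: succ_fm_def sats_less_fm)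
  also have "\<dots> \<longleftrightarrow> k y = Suc (k x)"
  proof
    assume *: "k x < k y \<and> \<not> (\<exists>n<M. k x < n \<and> n < k y)"
    moreover have "k y < M" using assms(1) by (simp add: good_def)
    \<comment> \<open>Otherwise \<open>Suc (k x)\<close> would itself be a represented number
      strictly between.\<close>
    ultimately have "\<not> Suc (k x) < k y" by (meson lessI less_trans)
    with * show "k y = Suc (k x)" by simp
  qed auto
  finally show ?thesis .
qed

text \<open>Variables 0 and 1 are bound in \<open>fact_fm\<close>, for the fact and its links;
  larger variables avoid capture.\<close>

lemma sats_fact_fm:
  assumes "good k" "\<forall>x\<in>set (y # xs). x > 1"
  shows "sats k (fact_fm f xs y) \<longleftrightarrow> holds f (map k xs) (k y)"
proof -
  have gt: "(y # xs) ! i > 1" if "i < Suc (length xs)" for i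
    using assms(2) nth_mem[of i "y # xs"] that by (metis length_Cons)
  have aux: "((y # xs) ! i = 0) = False" "((y # xs) ! i = 1) = False"
    "k ((y # xs) ! i) = (k y # map k xs) ! i" if "i < Suc (length xs)" for i
    using gt[OF that] nth_map[of i "y # xs" k] that by auto
  have "sats k (fact_fm f xs y) \<longleftrightarrow> (\<exists>t\<in>D. t \<in> X (to_nat (Fact f (length xs))) \<and>
      (\<forall>i\<in>{0..<Suc (length xs)}. \<exists>c\<in>D. c \<in> X (to_nat (Link i)) \<and> B t c (num ((k y # map k xs) ! i))))"
    by (simp add: sats_def fact_fm_def aux[unfolded One_nat_def] del: upt_Suc nth_Cons_Suc cong: ball_cong_simp)
  also have "\<dots> \<longleftrightarrow> holds f (map k xs) (k y)"
  proof -
    have "set (k y # map k xs) \<subseteq> {..<M}" using assms(1) by (auto simp: good_def)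
    then show ?thesis unfolding holds_def length_map by (simp add: Bex_def Ball_def conj_assoc)
  qed
  finally show ?thesis .
qed

text \<open>Quantifying over represented numbers loses nothing, as \<open>holds\<close> already
  bounds every witness that \<open>justified\<close> asks for.\<close>

lemma sats_justified_fm:
  assumes "good k"
  shows "sats k (justified_fm f a) \<longleftrightarrow> justified holds f (map k [4..<4 + a]) (k 3)"
proof (cases f)
  case Zero
  then show ?thesis using sats_Eq[OF assms, of 3 2] assms by (simp add: good_def)
next
  case Succ
  show ?thesis
  proof (cases "a = 1")
    case True
    then show ?thesis using assms by (simp add: Succ sats_succ_fm)
  next
    case False
    then have "length (map k [4..<4 + a]) \<noteq> length [x]" for x by simp
    then have "map k [4..<4 + a] \<noteq> [x]" for x by metis
    with False show ?thesis by (auto simp: Succ)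
  qed
next
  case (Proj i)
  then show ?thesis using sats_Eq[OF assms, of 3 "4 + i"] by auto
next
  case (Comp g gs)
  have "sats (update_from k (4 + a) ns) (Conj
      (conjs (map (\<lambda>i. fact_fm (gs ! i) [4..<4 + a] (4 + a + i)) [0..<length gs]))
      (fact_fm g [4 + a..<4 + a + length gs] 3)) \<longleftrightarrow>
      list_all2 (\<lambda>g. holds g (map k [4..<4 + a])) gs ns \<and> holds g ns (k 3)"
    if ns: "length ns = length gs" "set ns \<subseteq> {..<M}" for ns
  proof -
    let ?k = "update_from k (4 + a) ns"
    have good: "good ?k" using assms ns by (intro good_update_from) auto
    have "map ?k [4..<4 + a] = map k [4..<4 + a]"
      by (simp del: upt_Suc map_update_from)
    moreover have "?k (4 + a + i) = ns ! i" if "i < length gs" for i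
      using that ns by (simp add: update_from_def)
    ultimately have "sats ?k (fact_fm (gs ! i) [4..<4 + a] (4 + a + i)) \<longleftrightarrow>
        holds (gs ! i) (map k [4..<4 + a]) (ns ! i)" if "i < length gs" for i
      using that by (subst sats_fact_fm[OF good]) (auto simp del: map_eq_conv)
    moreover have "sats ?k (fact_fm g [4 + a..<4 + a + length gs] 3) \<longleftrightarrow> holds g ns (k 3)"
      using map_update_from[of k "4 + a" ns] ns by (subst sats_fact_fm[OF good]) auto
    ultimately show ?thesis using ns by (auto simp: list_all2_conv_all_nth)
  qed
  then have "sats k (justified_fm f a) \<longleftrightarrow> (\<exists>ns. length ns = length gs \<and> set ns \<subseteq> {..<M} \<and>
      list_all2 (\<lambda>g. holds g (map k [4..<4 + a])) gs ns \<and> holds g ns (k 3))"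
    unfolding Comp justified_fm.simps sats_ex_nums by (intro ex_cong1) blast
  \<comment> \<open>Length and bounds of \<open>ns\<close> follow from the other two
    conjuncts.\<close>
  also have "\<dots> \<longleftrightarrow> justified holds f (map k [4..<4 + a]) (k 3)"
    unfolding Comp justified.simps
    by (intro ex_cong1) (use holds_bounds(2) list_all2_lengthD in metis)
  finally show ?thesis .
next
  case (Prec g h)
  show ?thesis
  proof (cases "a = 0")
    case True
    then show ?thesis by (auto simp: Prec)
  next
    case False
    let ?ns = "map k [5..<4 + a]"
    have xs: "map k [4..<4 + a] = k 4 # ?ns" using False by (simp add: upt_conv_Cons)
    have "sats (k(4 + a := m, 5 + a := r)) (Conj (succ_fm (4 + a) 4) (Conj
         (fact_fm (Prec g h) ((4 + a) # [5..<4 + a]) (5 + a))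
         (fact_fm h ((4 + a) # (5 + a) # [5..<4 + a]) 3))) \<longleftrightarrow>
      k 4 = Suc m \<and> holds (Prec g h) (m # ?ns) r \<and> holds h (m # r # ?ns) (k 3)"
      if "m < M" "r < M" for m r
    proof -
      let ?k = "k(4 + a := m, 5 + a := r)"
      have good: "good ?k" using assms that by (intro good_upd) auto
      have "map ?k [5..<4 + a] = ?ns" by simp
      moreover have "?k (4 + a) = m" "?k (5 + a) = r" "?k 4 = k 4" "?k 3 = k 3"
        using False by simp_all
      ultimately show ?thesis
        by (simp add: sats_succ_fm[OF good] sats_fact_fm[OF good] del: fun_upd_apply upt_Suc)
    qed
    moreover have "sats k (Conj (Eq 4 2) (fact_fm g [5..<4 + a] 3)) \<longleftrightarrow> k 4 = 0 \<and> holds g ?ns (k 3)"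
      using assms sats_Eq[OF assms, of 4 2] by (auto simp: sats_fact_fm good_def)
    ultimately have "sats k (justified_fm f a) \<longleftrightarrow> k 4 = 0 \<and> holds g ?ns (k 3) \<or>
      (\<exists>m<M. \<exists>r<M. k 4 = Suc m \<and> holds (Prec g h) (m # ?ns) r \<and> holds h (m # r # ?ns) (k 3))"
      unfolding Prec justified_fm.simps if_not_P[OF False] sats_Neg sats_ex_num
        sats_Conj[of _ "Neg \<phi>" "Neg \<psi>" for \<phi> \<psi>] by blast
    also have "\<dots> \<longleftrightarrow> justified holds f (k 4 # ?ns) (k 3)"
    proof -
      have "m < M" if "holds f (m # zs) y" for f m zs y using holds_bounds(2)[OF that] by simp
      then show ?thesis unfolding Prec using holds_bounds(1) by (simp, blast)
    qed
    finally show ?thesis unfolding xs .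
  qed
next
  case (Mu g)
  let ?xs = "map k [4..<4 + a]"
  have witness: "sats (k(4 + a := i, 5 + a := w)) (Conj (Neg (Eq (5 + a) 2))
      (fact_fm g ((4 + a) # [4..<4 + a]) (5 + a))) \<longleftrightarrow> w > 0 \<and> holds g (i # ?xs) w"
    if "i < M" "w < M" for i w
  proof -
    let ?k = "k(4 + a := i, 5 + a := w)"
    have good: "good ?k" using assms that by (intro good_upd) auto
    have "map ?k [4..<4 + a] = ?xs" by simp
    moreover have "?k (5 + a) = w" "?k (4 + a) = i" "?k 2 = 0" using assms by (auto simp: good_def)
    ultimately show ?thesis
      using sats_Eq[OF good, of "5 + a" 2]
      by (simp add: sats_fact_fm[OF good] del: fun_upd_apply)
  qed
  have below: "sats (k(4 + a := i)) (less_fm (4 + a) 3) \<longleftrightarrow> i < k 3" if "i < M" for i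
    using that assms by (subst sats_less_fm) (auto intro: good_upd)
  have zero: "sats k (fact_fm g (3 # [4..<4 + a]) 2) \<longleftrightarrow> holds g (k 3 # ?xs) 0"
    using assms by (subst sats_fact_fm) (auto simp: good_def)
  have "sats k (justified_fm f a) \<longleftrightarrow> holds g (k 3 # ?xs) 0 \<and>
      (\<forall>i<M. i < k 3 \<longrightarrow> (\<exists>w<M. w > 0 \<and> holds g (i # ?xs) w))"
    unfolding Mu justified_fm.simps sats_Neg sats_ex_num
      sats_Conj[of _ "fact_fm f xs y" for f xs y] sats_Conj[of _ "less_fm x y" for x y] zero
    by (simp only: witness below cong: conj_cong) blast
  also have "\<dots> \<longleftrightarrow> justified holds f ?xs (k 3)"
  proof -
    \<comment> \<open>All smaller arguments are represented, so the bounded quantifier reaches each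
      of them.\<close>
    have "i < M" if "i < k 3" for i using assms that less_trans[of i "k 3" M] by (simp add: good_def)
    then show ?thesis unfolding Mu justified.simps using holds_bounds(1) by blast
  qed
  finally show ?thesis .
qed

lemma sats_rule_fm:
  assumes "good k"
  shows "sats k (rule_fm f a) \<longleftrightarrow>
    (\<forall>xs y. length xs = a \<longrightarrow> holds f xs y \<longrightarrow> justified holds f xs y)"
proof -
  have "sats (update_from k 3 ns) (imp (fact_fm f [4..<4 + a] 3) (justified_fm f a)) \<longleftrightarrow>
      (holds f xs y \<longrightarrow> justified holds f xs y)"
    if "ns = y # xs" "length xs = a" "set ns \<subseteq> {..<M}" for ns xs y
  proof -
    let ?k = "update_from k 3 ns"
    have good: "good ?k" using assms that by (intro good_update_from) auto
    have "map ?k [3..<3 + length ns] = ns" by (rule map_update_from)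
    then have "?k 3 = y" "map ?k [4..<4 + a] = xs"
      using that by (simp_all add: upt_conv_Cons)
    moreover have "sats ?k (fact_fm f [4..<4 + a] 3) \<longleftrightarrow> holds f (map ?k [4..<4 + a]) (?k 3)"
      by (rule sats_fact_fm[OF good]) auto
    ultimately show ?thesis using sats_justified_fm[OF good, of f a] by simp
  qed
  then have "sats k (rule_fm f a) \<longleftrightarrow> (\<forall>xs y. length xs = a \<and> set (y # xs) \<subseteq> {..<M} \<longrightarrow>
      holds f xs y \<longrightarrow> justified holds f xs y)"
    unfolding rule_fm_def sats_Neg sats_ex_nums length_Suc_conv by blast
  then show ?thesis using holds_bounds by auto
qed

text \<open>Each \<open>next_fm\<close> raises variable 3 by one. The successors needed are
  represented because \<open>holds\<close> bounds the final argument.\<close>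

lemma sats_next_fm_power:
  "good k \<Longrightarrow> sats k ((next_fm ^^ e) (result_fm p)) \<longleftrightarrow> (\<exists>y. holds p [k 3 + e] y)"
proof (induction e arbitrary: k)
  case 0
  have "sats (k(4 := n)) (fact_fm p [3] 4) \<longleftrightarrow> holds p [k 3] n" if "n < M" for n
    using 0 that by (subst sats_fact_fm) (auto intro: good_upd)
  then have "sats k (result_fm p) \<longleftrightarrow> (\<exists>n<M. holds p [k 3] n)"
    unfolding result_fm_def sats_ex_num by blast
  then show ?case using holds_bounds(1) by auto
next
  case (Suc e)
  have "sats (k(4 := n)) (Conj (succ_fm 3 4) (Ex 3 (Conj (Eq 3 4) ((next_fm ^^ e) (result_fm p))))) \<longleftrightarrow>
      n = Suc (k 3) \<and> (\<exists>y. holds p [n + e] y)" if "n < M" for n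
  proof -
    have good: "good (k(4 := n))" "good (k(4 := n, 3 := n))"
      using Suc.prems that by (auto intro!: good_upd)
    have subst: "sats (k(4 := n)) (Ex 3 (Conj (Eq 3 4) \<phi>)) \<longleftrightarrow> sats (k(4 := n, 3 := n)) \<phi>" for \<phi>
      using sats_let[of "k(4 := n)" 4 3 \<phi>] that unfolding fun_upd_same by simp
    show ?thesis
      unfolding sats_Conj subst Suc.IH[OF good(2)] fun_upd_same
      using sats_succ_fm[OF good(1), of 3 4]
      by (simp add: fun_upd_same fun_upd_other del: fun_upd_apply)
  qed
  then have "sats k ((next_fm ^^ Suc e) (result_fm p)) \<longleftrightarrow>
      (\<exists>n<M. n = Suc (k 3) \<and> (\<exists>y. holds p [n + e] y))"
    unfolding funpow.simps comp_apply next_fm_def sats_ex_num by blast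
  also have "\<dots> \<longleftrightarrow> (\<exists>y. holds p [k 3 + Suc e] y)"
  proof -
    have "Suc (k 3) < M" if "holds p [k 3 + Suc e] y" for y using holds_bounds(2)[OF that] by simp
    then show ?thesis by auto
  qed
  finally show ?case .
qed

lemma sats_body_fm:
  assumes "good k"
  shows "sats k (body_fm p e) \<longleftrightarrow>
    (\<forall>f xs y. (f, length xs) \<in> set (subprograms p 1) \<longrightarrow> holds f xs y \<longrightarrow> justified holds f xs y) \<and>
    (\<exists>y. holds p [e] y)"
proof -
  have "good (k(3 := 0))" using assms M_pos by (intro good_upd) auto
  moreover have "k 2 = 0" using assms by (simp add: good_def)
  ultimately have "sats k (Ex 3 (Conj (Eq 3 2) ((next_fm ^^ e) (result_fm p)))) \<longleftrightarrow>
      (\<exists>y. holds p [e] y)"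
    using sats_next_fm_power[of "k(3 := 0)" e p] M_pos by (simp add: sats_let)
  moreover have "sats k (conjs (map (\<lambda>(f, a). rule_fm f a) (subprograms p 1))) \<longleftrightarrow>
    (\<forall>f xs y. (f, length xs) \<in> set (subprograms p 1) \<longrightarrow> holds f xs y \<longrightarrow> justified holds f xs y)"
    using assms by (auto simp: sats_rule_fm)
  ultimately show ?thesis by (simp add: body_fm_def)
qed

lemma sats_order_fm: "good k \<Longrightarrow> sats k order_fm"
proof -
  assume k: "good k"
  have "sats k' (Bet 2 x y) \<longleftrightarrow> k' x \<le> k' y" if "good k'" for k' x y
    using that by (simp add: sats_def good_def order)
  moreover have "good (k(3 := i, 4 := j))" if "i < M" "j < M" for i j
    using k that by (intro good_upd) auto
  ultimately show ?thesis by (simp add: order_fm_def linear)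
qed

text \<open>\<open>holds\<close> serves as the relation \<open>R\<close> of
  \<open>computes_if_justified\<close>.\<close>

lemma computes_if_sats_body_fm:
  assumes "good k" "sats k (body_fm p e)"
  shows "\<exists>y. computes p [e] y"
  using assms computes_if_justified[of p "[e]" holds] by (auto simp: sats_body_fm)

end

section \<open>The reduction\<close>

text \<open>Points comparable from \<open>z\<close> and equally far from it coincide, so sorting by
  that distance enumerates \<open>N\<close>, and betweenness from \<open>z\<close> becomes the order
  of the indices. The first point is \<open>z\<close>, at distance 0.\<close>

lemma numbered_structure_if_ordered:
  fixes X :: "nat \<Rightarrow> (real^'n) set"
  defines "N \<equiv> X (to_nat Number)"
  assumes "finite N" "N \<subseteq> D" "z \<in> N"
    and ordered: "\<And>a b. a \<in> N \<Longrightarrow> b \<in> N \<Longrightarrow> betw z a b \<or> betw z b a"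
  obtains num M where "numbered_structure D betw X num M" "num 0 = z"
proof -
  define L where "L = sorted_list_of_set (dist z ` N)"
  define M where "M = card N"
  define num where "num = (\<lambda>i. inv_into N (dist z) (L ! i))"
  have betw_iff: "betw z a b \<longleftrightarrow> dist z a \<le> dist z b" if "a \<in> N" "b \<in> N" for a b
    using ordered[OF that] zero_le_dist[of a b] zero_le_dist[of b a] by (auto simp: betw_def)
  have inj: "inj_on (dist z) N"
  proof (rule inj_onI)
    fix a b assume "a \<in> N" "b \<in> N" "dist z a = dist z b"
    then have "betw z a b" by (simp add: betw_iff)
    with \<open>dist z a = dist z b\<close> show "a = b" by (simp add: betw_def)
  qed
  have L: "set L = dist z ` N" "sorted_wrt (<) L" "length L = M"
    using assms(2) inj by (simp_all add: L_def M_def card_image)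
  have num: "num i \<in> N" "dist z (num i) = L ! i" if "i < M" for i
  proof -
    have "L ! i \<in> dist z ` N" using that L nth_mem by metis
    then show "num i \<in> N" "dist z (num i) = L ! i"
      unfolding num_def by (auto simp: inv_into_into f_inv_into_f)
  qed
  have le: "L ! i \<le> L ! j \<longleftrightarrow> i \<le> j" if "i < M" "j < M" for i j
    using sorted_wrt_nth_less[OF L(2), of i j] sorted_wrt_nth_less[OF L(2), of j i] that L(3)
    by (cases i j rule: linorder_cases) auto
  have inj_num: "inj_on num {..<M}"
    using num(2) le by (metis antisym inj_onI lessThan_iff order_refl)
  have img: "num ` {..<M} = N"
    using num(1) inj_num assms(2) by (intro card_subset_eq) (auto simp: M_def card_image)
  have M_pos: "M > 0" using assms(2,4) by (auto simp: M_def card_gt_0_iff)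
  have "0 \<in> set L" using L(1) assms(4) by force
  then obtain i where "i < M" "L ! i = 0" using L(3) by (auto simp: in_set_conv_nth)
  then have "dist z (num 0) \<le> 0" using le[OF M_pos, of i] num(2)[OF M_pos] by simp
  then have z: "num 0 = z" by simp
  have "numbered_structure D betw X num M"
  proof
    show "betw (num 0) (num i) (num j) \<longleftrightarrow> i \<le> j" if "i < M" "j < M" for i j
      using that num le z by (simp add: betw_iff)
  qed (use M_pos img inj_num assms(3) N_def in auto)
  with z show thesis using that by blast
qed

lemma computes_if_sat_halting_fm:
  fixes X :: "nat \<Rightarrow> (real^'n) set"
  assumes "sat D betw X v (halting_fm p e)"
    and "finite (X (to_nat Number))" "X (to_nat Number) \<subseteq> D"
  shows "\<exists>y. computes p [e] y"
proof -
  obtain z where z: "z \<in> X (to_nat Number)" "sat D betw X (v(2 := z)) order_fm"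
    "sat D betw X (v(2 := z)) (body_fm p e)"
    using assms(1) by (auto simp: halting_fm_def ex_num_def)
  have "betw z a b \<or> betw z b a" if "a \<in> X (to_nat Number)" "b \<in> X (to_nat Number)" for a b
    using z(2) that assms(3) by (auto simp: order_fm_def ex_num_def)
  then obtain num M where "numbered_structure D betw X num M" and 0: "num 0 = z"
    using numbered_structure_if_ordered[of X D z] assms(2,3) z(1) by metis
  then interpret numbered_structure D betw X num M by simp
  \<comment> \<open>At most variable 2 is free in \<open>body_fm\<close>, and both assignments give
    it the value \<open>z\<close>.\<close>
  have "sats (\<lambda>_. 0) (body_fm p e) \<longleftrightarrow> sat D betw X (v(2 := z)) (body_fm p e)"
    unfolding sats_def using fo_vars_body_fm[of p e] 0 by (intro sat_cong) auto
  then show ?thesis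
    using computes_if_sats_body_fm[of "\<lambda>_. 0" p e] z(3) M_pos by (simp add: good_def)
qed

text \<open>A finite closed set \<open>F\<close> of facts is laid out on the incidence configuration
  so that \<open>holds\<close> is exactly membership in \<open>F\<close>.\<close>

lemma sat_halting_fm_if_computes:
  fixes T :: "(real^'n) set"
  assumes "extends_linearly 2 T" "computes p [e] y"
  obtains X where "\<And>i. finite (X i)" "\<And>i. X i \<subseteq> T" "\<And>v. sat T betw X v (halting_fm p e)"
proof -
  obtain F where F: "finite F" "closed_facts F" "(p, [e], y) \<in> F"
    using derivable_if_computes[OF assms(2)] by (auto simp: derivable_def)
  define M where "M = Suc (Max (\<Union>(f, xs, y)\<in>F. set (y # xs)))"
  have bound: "set (y # xs) \<subseteq> {..<M}" if "(f, xs, y) \<in> F" for f xs y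
  proof
    fix n assume "n \<in> set (y # xs)"
    then have "n \<in> (\<Union>(f, xs, y)\<in>F. set (y # xs))" using that by blast
    then have "n \<le> Max (\<Union>(f, xs, y)\<in>F. set (y # xs))" using F(1) by (intro Max_ge) auto
    then show "n \<in> {..<M}" by (simp add: M_def)
  qed
  obtain ix :: "recf \<times> nat list \<times> nat \<Rightarrow> nat" and K where ix: "inj_on ix F" "ix ` F = {..<K}"
    using finite_imp_inj_to_nat_seg[OF F(1)] by (auto simp: lessThan_def)
  obtain num t :: "nat \<Rightarrow> real^'n" and c where conf: "range num \<subseteq> T" "range t \<subseteq> T"
    "\<And>j i. j < K \<Longrightarrow> i < M \<Longrightarrow> c j i \<in> T" "inj num" "inj t"
    "\<And>i i'. betw (num 0) (num i) (num i') \<longleftrightarrow> i \<le> i'"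
    and inc: "\<And>j i j' i'. j < K \<Longrightarrow> i < M \<Longrightarrow> j' < K \<Longrightarrow> i' < M \<Longrightarrow>
      betw (t j') (c j i) (num i') \<longleftrightarrow> j = j' \<and> i = i'"
    using incidence_configuration[OF assms(1), of K M] by blast
  define S where "S = (\<lambda>s. case s of
      Number \<Rightarrow> num ` {..<M}
    | Link i \<Rightarrow> {c (ix (f, xs, y)) ((y # xs) ! i) | f xs y. (f, xs, y) \<in> F \<and> i < Suc (length xs)}
    | Fact f a \<Rightarrow> {t (ix (f, xs, y)) | xs y. (f, xs, y) \<in> F \<and> length xs = a})"
  define X where "X = (\<lambda>i. if i \<in> range (to_nat :: role \<Rightarrow> nat) then S (from_nat i) else {})"
  have X: "X (to_nat s) = S s" for s by (simp add: X_def)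
  have ixK: "ix \<phi> < K" if "\<phi> \<in> F" for \<phi> using ix(2) that by auto
  have nthM: "(y # xs) ! i < M" if "(f, xs, y) \<in> F" "i < Suc (length xs)" for f xs y i
    using bound[OF that(1)] nth_mem[of i "y # xs"] that(2) by auto
  have S_sub: "S s \<subseteq> T" for s
    using conf(1,2,3) ixK nthM by (cases s) (auto simp: S_def simp del: nth_Cons_Suc)
  have S_fin: "finite (S s)" for s
  proof (cases s)
    case (Link i)
    have "S s \<subseteq> (\<lambda>(f, xs, y). c (ix (f, xs, y)) ((y # xs) ! i)) ` F"
      by (force simp: S_def Link)
    then show ?thesis using F(1) finite_surj by blast
  next
    case (Fact f a)
    have "S s \<subseteq> (\<lambda>\<phi>. t (ix \<phi>)) ` F" by (force simp: S_def Fact)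
    then show ?thesis using F(1) finite_surj by blast
  qed (simp add: S_def)
  interpret numbered_structure T betw X num M
    by unfold_locales (use conf in \<open>auto simp: X S_def M_def inj_on_def inj_def\<close>)
  have holds_iff: "holds f xs y \<longleftrightarrow> (f, xs, y) \<in> F" for f xs y
  proof
    assume h: "holds f xs y"
    then obtain p where p: "p \<in> X (to_nat (Fact f (length xs)))"
      and links: "\<And>i. i < Suc (length xs) \<Longrightarrow> \<exists>q\<in>X (to_nat (Link i)). betw p q (num ((y # xs) ! i))"
      and bd: "set (y # xs) \<subseteq> {..<M}"
      unfolding holds_def by blast
    from p obtain xs' y' where F': "(f, xs', y') \<in> F" "length xs' = length xs" "p = t (ix (f, xs', y'))"
      by (auto simp: X S_def)
    \<comment> \<open>A link found here could stem from another fact \<open>g\<close>. The incidence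
      condition excludes this: it forces the same fact and the same number.\<close>
    have "(y # xs) ! i = (y' # xs') ! i" if i: "i < Suc (length xs)" for i
    proof -
      obtain g zs w where g: "(g, zs, w) \<in> F" "i < Suc (length zs)"
        "betw p (c (ix (g, zs, w)) ((w # zs) ! i)) (num ((y # xs) ! i))"
        using links[OF i] by (auto simp: X S_def)
      have "(y # xs) ! i < M" using bd nth_mem[of i "y # xs"] i by auto
      then have "ix (g, zs, w) = ix (f, xs', y')" "(w # zs) ! i = (y # xs) ! i"
        using g F' inc[OF ixK[OF g(1)] nthM[OF g(1,2)] ixK[OF F'(1)]] by blast+
      then show ?thesis using inj_onD[OF ix(1) _ g(1) F'(1)] by auto
    qed
    then have "y # xs = y' # xs'" using F'(2) by (intro nth_equalityI) auto
    then show "(f, xs, y) \<in> F" using F'(1) by simp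
  next
    assume f: "(f, xs, y) \<in> F"
    have "t (ix (f, xs, y)) \<in> T \<inter> X (to_nat (Fact f (length xs)))"
      using f conf(2) by (auto simp: X S_def)
    moreover have "c (ix (f, xs, y)) ((y # xs) ! i) \<in> T \<inter> X (to_nat (Link i)) \<and>
        betw (t (ix (f, xs, y))) (c (ix (f, xs, y)) ((y # xs) ! i)) (num ((y # xs) ! i))"
      if "i < Suc (length xs)" for i
      using inc[OF ixK[OF f] nthM[OF f that] ixK[OF f] nthM[OF f that]]
        conf(3)[OF ixK[OF f] nthM[OF f that]] f that unfolding X S_def by auto
    ultimately show "holds f xs y" using bound[OF f] unfolding holds_def by blast
  qed
  have good: "good (\<lambda>_. 0)" using M_pos by (simp add: good_def)
  have "justified holds f xs y" if "holds f xs y" for f xs y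
    using F(2) that by (auto simp: closed_facts_def holds_iff[abs_def])
  then have "sats (\<lambda>_. 0) (halting_fm p e)"
    unfolding halting_fm_def sats_ex_num
    using M_pos good F(3) sats_body_fm[OF good] sats_order_fm[OF good]
    by (intro exI[of _ 0]) (auto simp: holds_iff fun_upd_idem)
  then have sat: "sat T betw X v (halting_fm p e)" for v
    unfolding sats_def using fo_vars_halting_fm[of p e] sat_cong[of "halting_fm p e"] by (metis empty_iff)
  show thesis
  proof (rule that)
    show "finite (X i)" "X i \<subseteq> T" for i using S_fin S_sub by (auto simp: X_def)
  qed (rule sat)
qed

text \<open>Only the iterated part of the sentence depends on \<open>e\<close>; the rest consists of
  constants combined by pairing.\<close>

lemma computable_halting_code: "computable (\<lambda>e. sentence_code (k, Neg (halting_fm p e)))"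
proof -
  \<comment> \<open>The code of \<open>next_fm\<close> applied to a formula with code
    \<open>n\<close>. The leading 5, 4, 4 are the tag of \<open>Ex\<close>, its variable and the tag
    of \<open>Conj\<close>.\<close>
  define w where "w = (\<lambda>n. prod_encode (5, prod_encode (4, prod_encode (4, prod_encode
    (fm_code (mem Number 4), prod_encode (4, prod_encode (fm_code (succ_fm 3 4), prod_encode
      (5, prod_encode (3, prod_encode (4, prod_encode (fm_code (Eq 3 4), n)))))))))))"
  have "fm_code ((next_fm ^^ e) (result_fm p)) = (w ^^ e) (fm_code (result_fm p))" for e
    by (induction e) (simp_all add: next_fm_def ex_num_def w_def)
  moreover have "computable (\<lambda>e. (w ^^ e) (fm_code (result_fm p)))"
    by (intro computable_iterate) (unfold w_def, intro computable_pair computable_const computable_id)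
  ultimately have "computable (\<lambda>e. fm_code ((next_fm ^^ e) (result_fm p)))" by simp
  then show ?thesis
    unfolding sentence_code_def halting_fm_def body_fm_def ex_num_def fst_conv snd_conv fm_code.simps
    by (intro computable_pair computable_const)
qed

theorem theorem8:
  fixes T :: "(real^'n) set"
  assumes "extends_linearly 2 T"
  shows "Pi01_hard (sentence_code ` weak_univ_theory T betw)"
  unfolding Pi01_hard_def
proof (intro allI impI)
  fix A assume "Pi01 A"
  then obtain p where p: "\<And>e. e \<notin> A \<longleftrightarrow> (\<exists>y. computes p [e] y)"
    by (auto simp: Pi01_def rec_enum_def)
  \<comment> \<open>\<open>k\<close> exceeds every set variable in use. Inserting
    \<open>to_nat Number\<close> yields directly that the set of numbers is among the finite sets
    quantified over.\<close>
  define k where "k = Suc (Max (insert (to_nat Number) (so_vars (halting_fm p 0))))"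
  have k: "to_nat Number < k" "so_vars (halting_fm p e) \<subseteq> {..<k}" for e
    unfolding so_vars_halting_fm[of p e] k_def
    using finite_so_vars[of "halting_fm p 0"] by (auto simp: less_Suc_eq_le)
  have "e \<in> A \<longleftrightarrow> (k, Neg (halting_fm p e)) \<in> weak_univ_theory T betw" for e
  proof
    assume "e \<in> A"
    then have "\<not> (\<exists>y. computes p [e] y)" using p by blast
    then have "\<not> sat T betw X v (halting_fm p e)" if "\<forall>i<k. finite (X i) \<and> X i \<subseteq> T" for X v
      using that k(1) computes_if_sat_halting_fm by blast
    then show "(k, Neg (halting_fm p e)) \<in> weak_univ_theory T betw"
      using k(2) by (simp add: weak_univ_theory_def fo_vars_halting_fm)
  next
    assume e: "(k, Neg (halting_fm p e)) \<in> weak_univ_theory T betw"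
    show "e \<in> A"
    proof (rule ccontr)
      assume "e \<notin> A"
      then obtain y where "computes p [e] y" using p by blast
      then obtain X where "\<And>i. finite (X i)" "\<And>i. X i \<subseteq> T" "\<And>v. sat T betw X v (halting_fm p e)"
        using sat_halting_fm_if_computes[OF assms] by blast
      then show False using e by (auto simp: weak_univ_theory_def)
    qed
  qed
  then have "e \<in> A \<longleftrightarrow> sentence_code (k, Neg (halting_fm p e)) \<in>
      sentence_code ` weak_univ_theory T betw" for e
    by (simp add: inj_image_mem_iff[OF inj_sentence_code])
  then show "many_one_reducible A (sentence_code ` weak_univ_theory T betw)"
    unfolding many_one_reducible_def using computable_halting_code[of k p] by blast
qed

end
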